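(* There does not exist an expanding $n$-dimensional almost $\alpha$-cosymplectic Ricci soliton $(M^n,g,\varphi,\xi,\eta)$ with potential field the Reeb vector field; that is, if $(M^n,g,\varphi,\xi,\eta)$ is an almost $\alpha$-cosymplectic manifold with Reeb vector field $\xi$ and $\lambda$ is a constant such that $(M^n,g,\xi,\lambda)$ is a Ricci soliton, then $\lambda\ge 0$.
   Context: A Ricci soliton $(M,g,X,\lambda)$ is a Riemannian manifold $(M,g)$ with a smooth vector field $X$ (the potential field) and a constant $\lambda\in\mathbb{R}$ such that $\frac12\mathcal{L}_Xg+\operatorname{Ric}=\lambda g$. It is expanding if $\lambda<0$. An almost contact metric manifold $(M^n,g,\varphi,\xi,\eta)$ ($n$ odd) is a Riemannian manifold with a $(1,1)$-tensor field $\varphi$, a unit vector field $\xi$ (the Reeb vector field) and its dual $1$-form $\eta$ satisfying $\varphi^2=-I+\eta\otimes\xi$, $\varphi\xi=0$, $\eta\circ\varphi=0$, $g(\varphi U,\varphi V)=g(U,V)-\eta(U)\eta(V)$. It is almost $\alpha$-cosymplectic, for a constant $\alpha\in\mathbb{R}$, if $d\eta=0$ and $d\Phi=2\alpha\,\eta\wedge\Phi$, where $\Phi(U,V)=g(U,\varphi V)$. *)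

theory Defs
  imports "HOL-Analysis.Analysis"
begin

section \<open>Smooth functions on open subsets of Euclidean space\<close>

definition pderiv_at :: "'n::finite \<Rightarrow> (real^'n \<Rightarrow> 'b::real_normed_vector) \<Rightarrow> real^'n \<Rightarrow> 'b"
  where "pderiv_at i f x = frechet_derivative f (at x) (axis i 1)"

primrec Ck_on :: "nat \<Rightarrow> (real^'n) set \<Rightarrow> (real^'n::finite \<Rightarrow> 'b::real_normed_vector) \<Rightarrow> bool"
  where
    "Ck_on 0 S f \<longleftrightarrow> continuous_on S f"
  | "Ck_on (Suc k) S f \<longleftrightarrow> (\<forall>x\<in>S. f differentiable (at x)) \<and> (\<forall>i. Ck_on k S (pderiv_at i f))"

text \<open>Only used for open \<open>S\<close>.\<close>

definition smooth_on :: "(real^'n) set \<Rightarrow> (real^'n::finite \<Rightarrow> 'b::real_normed_vector) \<Rightarrow> bool"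
  where "smooth_on S f \<longleftrightarrow> (\<forall>k. Ck_on k S f)"


section \<open>Smooth manifolds\<close>

text \<open>A chart is a pair of its domain (a subset of the manifold) and its coordinate map; the
  coordinate map is irrelevant outside the domain.\<close>

type_synonym ('a, 'n) chart = "'a set \<times> ('a \<Rightarrow> real^'n)"

definition chart_image :: "('a, 'n::finite) chart \<Rightarrow> (real^'n) set"
  where "chart_image c = snd c ` fst c"

definition transition :: "('a, 'n::finite) chart \<Rightarrow> ('a, 'n) chart \<Rightarrow> real^'n \<Rightarrow> real^'n"
  where "transition c d = snd d \<circ> inv_into (fst c) (snd c)"

definition overlap :: "('a, 'n::finite) chart \<Rightarrow> ('a, 'n) chart \<Rightarrow> (real^'n) set"
  where "overlap c d = snd c ` (fst c \<inter> fst d)"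

text \<open>Manifolds are nonempty, Hausdorff and second countable; connectedness is not required.
  The dimension is \<open>CARD('n)\<close>.\<close>

locale smooth_manifold =
  fixes M :: "'a topology" and A :: "('a, 'n::finite) chart set"
  assumes nonempty: "topspace M \<noteq> {}"
    and Hausdorff: "Hausdorff_space M"
    and second_countable: "second_countable M"
    and covers: "\<Union>(fst ` A) = topspace M"
    and chart_open: "c \<in> A \<Longrightarrow> openin M (fst c) \<and> open (chart_image c)"
    and chart_homeo: "c \<in> A \<Longrightarrow>
      homeomorphic_map (subtopology M (fst c)) (top_of_set (chart_image c)) (snd c)"
    and transition_smooth: "c \<in> A \<Longrightarrow> d \<in> A \<Longrightarrow> smooth_on (overlap c d) (transition c d)"


section \<open>Tensor fields\<close>

text \<open>A tensor field is given by its components in the charts of the atlas, as functions of the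
  coordinates, subject to smoothness and to the transformation law under changes of coordinates.
  With \<open>J = \<partial>y/\<partial>x\<close> the Jacobian matrix of the transition map \<open>x \<mapsto> y\<close> (row index: component of
  \<open>y\<close>, column index: differentiation variable), the components transform as
  \<open>V' = J V\<close>, \<open>\<omega> = J\<^sup>T \<omega>'\<close>, \<open>F' J = J F\<close> and \<open>T = J\<^sup>T T' J\<close> respectively.
  A \<open>(1,1)\<close>-tensor \<open>F\<close> acts on vectors by \<open>F *v V\<close>, so that \<open>F $ i $ j\<close> has upper index \<open>i\<close>
  and lower index \<open>j\<close>. Values outside the charts and their images are irrelevant.\<close>

type_synonym ('a, 'n, 'b) field_on_charts = "('a, 'n) chart \<Rightarrow> real^'n \<Rightarrow> 'b"

definition is_tensor_field ::
    "((real^'n^'n) \<Rightarrow> 'b \<Rightarrow> 'b \<Rightarrow> bool) \<Rightarrow> ('a, 'n::finite) chart set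
      \<Rightarrow> ('a, 'n, 'b::real_normed_vector) field_on_charts \<Rightarrow> bool"
  where "is_tensor_field law A T \<longleftrightarrow>
    (\<forall>c\<in>A. smooth_on (chart_image c) (T c)) \<and>
    (\<forall>c\<in>A. \<forall>d\<in>A. \<forall>x\<in>overlap c d.
        law (jacobian (transition c d) (at x)) (T c x) (T d (transition c d x)))"

definition vector_field :: "('a, 'n::finite) chart set \<Rightarrow> ('a, 'n, real^'n) field_on_charts \<Rightarrow> bool"
  where "vector_field = is_tensor_field (\<lambda>J V V'. V' = J *v V)"

definition one_form :: "('a, 'n::finite) chart set \<Rightarrow> ('a, 'n, real^'n) field_on_charts \<Rightarrow> bool"
  where "one_form = is_tensor_field (\<lambda>J w w'. w = transpose J *v w')"

definition tensor_field_1_1 ::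
    "('a, 'n::finite) chart set \<Rightarrow> ('a, 'n, real^'n^'n) field_on_charts \<Rightarrow> bool"
  where "tensor_field_1_1 = is_tensor_field (\<lambda>J F F'. F' ** J = J ** F)"

definition tensor_field_0_2 ::
    "('a, 'n::finite) chart set \<Rightarrow> ('a, 'n, real^'n^'n) field_on_charts \<Rightarrow> bool"
  where "tensor_field_0_2 = is_tensor_field (\<lambda>J T T'. T = transpose J ** T' ** J)"

definition bilin :: "real^'n^'n \<Rightarrow> real^'n \<Rightarrow> real^'n \<Rightarrow> real"
  where "bilin T U V = U \<bullet> (T *v V)"


section \<open>Riemannian manifolds\<close>

locale riemannian_manifold = smooth_manifold M A
  for M :: "'a topology" and A :: "('a, 'n::finite) chart set" +
  fixes g :: "('a, 'n, real^'n^'n) field_on_charts"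
  assumes metric_tensor: "tensor_field_0_2 A g"
    and metric_symmetric: "c \<in> A \<Longrightarrow> x \<in> chart_image c \<Longrightarrow> transpose (g c x) = g c x"
    and metric_pos: "c \<in> A \<Longrightarrow> x \<in> chart_image c \<Longrightarrow> U \<noteq> 0 \<Longrightarrow> bilin (g c x) U U > 0"

text \<open>The operators below act on component functions in a single chart.\<close>

definition coord_field :: "'n \<Rightarrow> real^'n \<Rightarrow> real^'n::finite"
  where "coord_field i = (\<lambda>x. axis i 1)"

definition dir_deriv :: "(real^'n \<Rightarrow> real^'n) \<Rightarrow> (real^'n::finite \<Rightarrow> 'b::real_normed_vector) \<Rightarrow> real^'n \<Rightarrow> 'b"
  where "dir_deriv X f x = (\<Sum>i\<in>UNIV. (X x $ i) *\<^sub>R pderiv_at i f x)"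

definition lie_bracket :: "(real^'n \<Rightarrow> real^'n) \<Rightarrow> (real^'n \<Rightarrow> real^'n) \<Rightarrow> real^'n::finite \<Rightarrow> real^'n"
  where "lie_bracket X Y x = dir_deriv X Y x - dir_deriv Y X x"

text \<open>\<open>(L\<^sub>X g)(Y,Z) = X (g(Y,Z)) - g([X,Y],Z) - g(Y,[X,Z])\<close> on coordinate fields \<open>Y\<close>, \<open>Z\<close>.\<close>

definition lie_deriv :: "(real^'n \<Rightarrow> real^'n) \<Rightarrow> (real^'n \<Rightarrow> real^'n^'n) \<Rightarrow> real^'n::finite \<Rightarrow> real^'n^'n"
  where "lie_deriv X G x = (\<chi> i j.
      dir_deriv X (\<lambda>y. G y $ i $ j) x
      - bilin (G x) (lie_bracket X (coord_field i) x) (coord_field j x)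
      - bilin (G x) (coord_field i x) (lie_bracket X (coord_field j) x))"

text \<open>\<open>\<Gamma>\<^sup>k\<^sub>i\<^sub>j = 1/2 g\<^sup>k\<^sup>l (\<partial>\<^sub>i g\<^sub>j\<^sub>l + \<partial>\<^sub>j g\<^sub>i\<^sub>l - \<partial>\<^sub>l g\<^sub>i\<^sub>j)\<close>\<close>

definition christoffel :: "(real^'n \<Rightarrow> real^'n^'n) \<Rightarrow> 'n \<Rightarrow> 'n \<Rightarrow> 'n \<Rightarrow> real^'n::finite \<Rightarrow> real"
  where "christoffel G k i j x = 1/2 * (\<Sum>l\<in>UNIV. matrix_inv (G x) $ k $ l *
      (pderiv_at i (\<lambda>y. G y $ j $ l) x + pderiv_at j (\<lambda>y. G y $ i $ l) x
        - pderiv_at l (\<lambda>y. G y $ i $ j) x))"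

text \<open>The Levi-Civita connection \<open>\<nabla>\<^sub>X Y\<close>.\<close>

definition levi_civita ::
    "(real^'n \<Rightarrow> real^'n^'n) \<Rightarrow> (real^'n \<Rightarrow> real^'n) \<Rightarrow> (real^'n \<Rightarrow> real^'n) \<Rightarrow> real^'n::finite \<Rightarrow> real^'n"
  where "levi_civita G X Y x = dir_deriv X Y x +
      (\<chi> k. \<Sum>i\<in>UNIV. \<Sum>j\<in>UNIV. christoffel G k i j x * (X x $ i) * (Y x $ j))"

definition curvature ::
    "(real^'n \<Rightarrow> real^'n^'n) \<Rightarrow> (real^'n \<Rightarrow> real^'n) \<Rightarrow> (real^'n \<Rightarrow> real^'n) \<Rightarrow> (real^'n \<Rightarrow> real^'n)
      \<Rightarrow> real^'n::finite \<Rightarrow> real^'n"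
  where "curvature G X Y Z x =
      levi_civita G X (levi_civita G Y Z) x - levi_civita G Y (levi_civita G X Z) x
      - levi_civita G (lie_bracket X Y) Z x"

text \<open>\<open>Ric(Y,Z)\<close> is the trace of \<open>X \<mapsto> R(X,Y)Z\<close>; round spheres have positive Ricci curvature.\<close>

definition ricci :: "(real^'n \<Rightarrow> real^'n^'n) \<Rightarrow> real^'n::finite \<Rightarrow> real^'n^'n"
  where "ricci G x =
      (\<chi> j k. \<Sum>i\<in>UNIV. curvature G (coord_field i) (coord_field j) (coord_field k) x $ i)"

locale ricci_soliton = riemannian_manifold M A g
  for M :: "'a topology" and A :: "('a, 'n::finite) chart set" and g +
  fixes X :: "('a, 'n, real^'n) field_on_charts" and lam :: real
  assumes potential_field: "vector_field A X"
    and soliton: "c \<in> A \<Longrightarrow> x \<in> chart_image c \<Longrightarrow>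
      (1/2) *\<^sub>R lie_deriv (X c) (g c) x + ricci (g c) x = lam *\<^sub>R g c x"


section \<open>Almost contact metric and almost cosymplectic structures\<close>

definition ext_deriv1 :: "(real^'n \<Rightarrow> real^'n) \<Rightarrow> real^'n::finite \<Rightarrow> 'n \<Rightarrow> 'n \<Rightarrow> real"
  where "ext_deriv1 w x i j =
      pderiv_at i (\<lambda>y. w y $ j) x - pderiv_at j (\<lambda>y. w y $ i) x"

text \<open>Some authors put a common factor \<open>1/3\<close> in front of both cyclic sums below (and \<open>1/2\<close> in
  front of the exterior derivative of a 1-form); the conditions imposed in
  \<open>almost_cosymplectic_manifold\<close> do not depend on that choice.\<close>

definition ext_deriv2 :: "(real^'n \<Rightarrow> real^'n^'n) \<Rightarrow> real^'n::finite \<Rightarrow> 'n \<Rightarrow> 'n \<Rightarrow> 'n \<Rightarrow> real"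
  where "ext_deriv2 W x i j k =
      pderiv_at i (\<lambda>y. W y $ j $ k) x + pderiv_at j (\<lambda>y. W y $ k $ i) x
      + pderiv_at k (\<lambda>y. W y $ i $ j) x"

definition wedge12 :: "real^'n \<Rightarrow> real^'n^'n \<Rightarrow> 'n::finite \<Rightarrow> 'n \<Rightarrow> 'n \<Rightarrow> real"
  where "wedge12 w W i j k = w $ i * W $ j $ k + w $ j * W $ k $ i + w $ k * W $ i $ j"

locale almost_contact_metric_manifold = riemannian_manifold M A g
  for M :: "'a topology" and A :: "('a, 'n::finite) chart set" and g +
  fixes \<phi> :: "('a, 'n, real^'n^'n) field_on_charts"
    and \<xi> \<eta> :: "('a, 'n, real^'n) field_on_charts"
  assumes odd_dim: "odd CARD('n)"
    and phi_tensor: "tensor_field_1_1 A \<phi>"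
    and xi_field: "vector_field A \<xi>"
    and eta_form: "one_form A \<eta>"
    and xi_unit: "c \<in> A \<Longrightarrow> x \<in> chart_image c \<Longrightarrow> bilin (g c x) (\<xi> c x) (\<xi> c x) = 1"
    and eta_dual: "c \<in> A \<Longrightarrow> x \<in> chart_image c \<Longrightarrow> \<eta> c x \<bullet> U = bilin (g c x) (\<xi> c x) U"
    and phi_sq: "c \<in> A \<Longrightarrow> x \<in> chart_image c \<Longrightarrow>
      \<phi> c x *v (\<phi> c x *v U) = - U + (\<eta> c x \<bullet> U) *\<^sub>R \<xi> c x"
    and phi_xi: "c \<in> A \<Longrightarrow> x \<in> chart_image c \<Longrightarrow> \<phi> c x *v \<xi> c x = 0"
    and eta_phi: "c \<in> A \<Longrightarrow> x \<in> chart_image c \<Longrightarrow> \<eta> c x \<bullet> (\<phi> c x *v U) = 0"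
    and phi_compatible: "c \<in> A \<Longrightarrow> x \<in> chart_image c \<Longrightarrow>
      bilin (g c x) (\<phi> c x *v U) (\<phi> c x *v V)
        = bilin (g c x) U V - (\<eta> c x \<bullet> U) * (\<eta> c x \<bullet> V)"
begin

text \<open>The fundamental form \<open>\<Phi>(U,V) = g(U, \<phi>V)\<close>, evaluated on coordinate fields.\<close>

definition fundamental_form :: "('a, 'n, real^'n^'n) field_on_charts"
  where "fundamental_form c x = (\<chi> i j. bilin (g c x) (axis i 1) (\<phi> c x *v axis j 1))"

end

locale almost_cosymplectic_manifold = almost_contact_metric_manifold M A g \<phi> \<xi> \<eta>
  for M :: "'a topology" and A :: "('a, 'n::finite) chart set" and g \<phi> \<xi> \<eta> +
  fixes \<alpha> :: real
  assumes eta_closed: "c \<in> A \<Longrightarrow> x \<in> chart_image c \<Longrightarrow> ext_deriv1 (\<eta> c) x i j = 0"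
    and d_fundamental_form: "c \<in> A \<Longrightarrow> x \<in> chart_image c \<Longrightarrow>
      ext_deriv2 (fundamental_form c) x i j k
        = 2 * \<alpha> * wedge12 (\<eta> c x) (fundamental_form c x) i j k"

end

theory Submission
  imports Defs
begin

text \<open>The bound comes from the identity \<open>\<lambda> = |\<nabla>\<xi>|\<^sup>2\<close>, which holds for every Ricci soliton whose potential
  field \<open>\<xi>\<close> has unit length and a closed dual 1-form \<open>\<eta>\<close>.

  Let \<open>S V = \<nabla>\<^sub>V \<xi>\<close>. Since \<open>\<eta>\<close> is closed, \<open>S\<close> is self-adjoint (\<open>metric_S_sym\<close>), so that
  \<open>L\<^sub>\<xi> g = 2 g(S\<cdot>,\<cdot>)\<close> and the soliton equation reads \<open>Ric = \<lambda> g - g(S\<cdot>,\<cdot>)\<close>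
  (\<open>ricci_soliton_domain\<close>). As \<open>\<xi>\<close> is also a unit field, \<open>S \<xi> = 0\<close> (\<open>S_xi\<close>); hence \<open>Ric(\<xi>) = \<lambda> \<eta>\<close>.
  The divergence of \<open>S\<close> is now computed in two ways. The traced Ricci identity
  (\<open>ricci_xi_bochner\<close>) says \<open>Ric(\<xi>) = div S - d(tr S)\<close>. The contracted second Bianchi identity
  \<open>2 div Ric = d scal\<close> (\<open>contracted_bianchi\<close>), applied to the soliton, says \<open>2 div S = d(tr S)\<close>
  (\<open>div_nabla_xi_bianchi\<close>). Together, \<open>\<lambda> \<eta> = Ric(\<xi>) = - div S\<close>. Contracting with \<open>\<xi>\<close> and using
  \<open>0 = div(S \<xi>) = (div S)(\<xi>) + tr S\<^sup>2\<close> gives \<open>\<lambda> = tr S\<^sup>2\<close> (\<open>lam_eq_trace_square\<close>), and the square of a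
  self-adjoint endomorphism has nonnegative trace (\<open>lam_nonneg\<close>).

  The argument is local and runs in a single chart. The connection is treated as a family of matrices \<open>\<Gamma>\<^sub>i\<close>, the curvature as \<open>R\<^sub>i\<^sub>j = \<partial>\<^sub>i \<Gamma>\<^sub>j - \<partial>\<^sub>j \<Gamma>\<^sub>i + [\<Gamma>\<^sub>i, \<Gamma>\<^sub>j]\<close>; then the second
  Bianchi identity is an identity in a noncommutative ring together with the symmetry of second
  partial derivatives (\<open>second_bianchi\<close>), and the skew symmetry of the curvature matrices
  (\<open>Rm_up_skew\<close>) expresses the symmetry of the second derivatives of the inverse metric.\<close>


section \<open>Rules for partial derivatives\<close>

lemma pderiv_at_has_derivative:
  "(f has_derivative f') (at x) \<Longrightarrow> pderiv_at i f x = f' (axis i 1)"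
  unfolding pderiv_at_def using frechet_derivative_at by metis

lemma pderiv_at_cong:
  assumes "open U" "x \<in> U" "\<And>y. y \<in> U \<Longrightarrow> f y = g y"
  shows "pderiv_at i f x = pderiv_at i g x"
proof -
  have "(f has_derivative D) (at x) \<longleftrightarrow> (g has_derivative D) (at x)" for D
    using assms has_derivative_transform_within_open[of f D x UNIV U g]
      has_derivative_transform_within_open[of g D x UNIV U f] by auto
  then show ?thesis
    unfolding pderiv_at_def frechet_derivative_def by simp
qed

lemma differentiable_cong_open:
  assumes "open U" "x \<in> U" "\<And>y. y \<in> U \<Longrightarrow> f y = g y" "f differentiable (at x)"
  shows "g differentiable (at x)"
  using assms unfolding differentiable_def
  by (metis has_derivative_transform_within_open)

lemma pderiv_at_const [simp]: "pderiv_at i (\<lambda>y. c) x = 0"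
  by (simp add: pderiv_at_def)

lemma pderiv_at_bounded_linear:
  assumes "bounded_linear L" "f differentiable (at x)"
  shows "pderiv_at i (\<lambda>y. L (f y)) x = L (pderiv_at i f x)"
proof -
  have "(f has_derivative frechet_derivative f (at x)) (at x)"
    using assms(2) frechet_derivative_works by blast
  from pderiv_at_has_derivative[OF bounded_linear.has_derivative[OF assms(1) this]]
  show ?thesis by (simp add: pderiv_at_def)
qed

lemma pderiv_at_bounded_bilinear:
  assumes "bounded_bilinear B" "f differentiable (at x)" "g differentiable (at x)"
  shows "pderiv_at i (\<lambda>y. B (f y) (g y)) x = B (f x) (pderiv_at i g x) + B (pderiv_at i f x) (g x)"
proof -
  have "(f has_derivative frechet_derivative f (at x)) (at x)"
    "(g has_derivative frechet_derivative g (at x)) (at x)"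
    using assms frechet_derivative_works by blast+
  from pderiv_at_has_derivative[OF bounded_bilinear.FDERIV[OF assms(1) this]]
  show ?thesis by (simp add: pderiv_at_def)
qed

lemma differentiable_bounded_linear:
  assumes "bounded_linear L" "f differentiable (at x)"
  shows "(\<lambda>y. L (f y)) differentiable (at x)"
  using assms unfolding differentiable_def by (blast intro: bounded_linear.has_derivative)

lemma differentiable_bounded_bilinear:
  assumes "bounded_bilinear B" "f differentiable (at x)" "g differentiable (at x)"
  shows "(\<lambda>y. B (f y) (g y)) differentiable (at x)"
  using assms unfolding differentiable_def by (blast intro: bounded_bilinear.FDERIV)

lemma pderiv_at_add:
  assumes "f differentiable (at x)" "g differentiable (at x)"
  shows "pderiv_at i (\<lambda>y. f y + g y) x = pderiv_at i f x + pderiv_at i g x"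
  using pderiv_at_has_derivative[OF has_derivative_add[OF assms[unfolded frechet_derivative_works]]]
  by (simp add: pderiv_at_def)

lemma pderiv_at_diff:
  assumes "f differentiable (at x)" "g differentiable (at x)"
  shows "pderiv_at i (\<lambda>y. f y - g y) x = pderiv_at i f x - pderiv_at i g x"
  using pderiv_at_has_derivative[OF has_derivative_diff[OF assms[unfolded frechet_derivative_works]]]
  by (simp add: pderiv_at_def)

lemma pderiv_at_uminus:
  assumes "f differentiable (at x)"
  shows "pderiv_at i (\<lambda>y. - f y) x = - pderiv_at i f x"
  by (rule pderiv_at_bounded_linear[OF bounded_linear_minus[OF bounded_linear_ident] assms])

lemma pderiv_at_sum:
  assumes "\<And>a. a \<in> I \<Longrightarrow> f a differentiable (at x)"
  shows "pderiv_at i (\<lambda>y. \<Sum>a\<in>I. f a y) x = (\<Sum>a\<in>I. pderiv_at i (f a) x)"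
proof -
  have "((\<lambda>y. \<Sum>a\<in>I. f a y) has_derivative (\<lambda>v. \<Sum>a\<in>I. frechet_derivative (f a) (at x) v)) (at x)"
    by (rule has_derivative_sum) (use assms frechet_derivative_works in blast)
  from pderiv_at_has_derivative[OF this] show ?thesis by (simp add: pderiv_at_def)
qed

lemma pderiv_at_nth:
  assumes "f differentiable (at x)"
  shows "pderiv_at i (\<lambda>y. f y $ a) x = pderiv_at i f x $ a"
  by (rule pderiv_at_bounded_linear[OF bounded_linear_vec_nth assms])

lemma pderiv_at_nth2:
  fixes f :: "real^'n \<Rightarrow> real^'m^'k"
  assumes "f differentiable (at x)"
  shows "pderiv_at i (\<lambda>y. f y $ a $ b) x = pderiv_at i f x $ a $ b"
  using pderiv_at_nth[OF differentiable_bounded_linear[OF bounded_linear_vec_nth assms]]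
    pderiv_at_nth[OF assms] by metis


section \<open>Closure properties of smooth functions\<close>

lemma Ck_on_cong:
  assumes "open U" "\<And>y. y \<in> U \<Longrightarrow> f y = g y" "Ck_on k U f"
  shows "Ck_on k U g"
  using assms(2,3)
proof (induction k arbitrary: f g)
  case 0
  then show ?case by (simp cong: continuous_on_cong)
next
  case (Suc k)
  have "Ck_on k U (pderiv_at i g)" for i
    by (rule Suc.IH[of "pderiv_at i f"])
       (use Suc.prems pderiv_at_cong[OF assms(1), of _ f g] in auto)
  then show ?case
    using Suc.prems differentiable_cong_open[OF assms(1)] by (metis Ck_on.simps(2))
qed

lemma Ck_on_Suc_imp: "Ck_on (Suc k) U f \<Longrightarrow> Ck_on k U f"
proof (induction k arbitrary: f)
  case 0
  then show ?case
    by (auto intro!: continuous_at_imp_continuous_on differentiable_imp_continuous_within)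
next
  case (Suc k)
  then show ?case by (metis Ck_on.simps(2))
qed

lemma Ck_on_add:
  assumes "open U" "Ck_on k U f" "Ck_on k U g"
  shows "Ck_on k U (\<lambda>y. f y + g y)"
  using assms(2,3)
proof (induction k arbitrary: f g)
  case 0
  then show ?case by (auto intro: continuous_intros)
next
  case (Suc k)
  have "Ck_on k U (pderiv_at i (\<lambda>y. f y + g y))" for i
    by (rule Ck_on_cong[OF assms(1) _ Suc.IH[of "pderiv_at i f" "pderiv_at i g"]])
       (use Suc.prems in \<open>auto simp: pderiv_at_add\<close>)
  then show ?case using Suc.prems by (auto intro: differentiable_add)
qed

lemma Ck_on_bounded_linear:
  assumes "open U" "bounded_linear L" "Ck_on k U f"
  shows "Ck_on k U (\<lambda>y. L (f y))"
  using assms(3)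
proof (induction k arbitrary: f)
  case 0
  then show ?case using linear_continuous_on_compose assms(2)
    by (auto intro: bounded_linear.continuous_on)
next
  case (Suc k)
  have "Ck_on k U (pderiv_at i (\<lambda>y. L (f y)))" for i
    by (rule Ck_on_cong[OF assms(1) _ Suc.IH[of "pderiv_at i f"]])
       (use Suc.prems in \<open>auto simp: pderiv_at_bounded_linear[OF assms(2)]\<close>)
  then show ?case using Suc.prems by (auto intro: differentiable_bounded_linear[OF assms(2)])
qed

lemma Ck_on_bounded_bilinear:
  assumes "open U" "bounded_bilinear B" "Ck_on k U f" "Ck_on k U g"
  shows "Ck_on k U (\<lambda>y. B (f y) (g y))"
  using assms(3,4)
proof (induction k arbitrary: f g)
  case 0
  then show ?case by (simp add: bounded_bilinear.continuous_on[OF assms(2)])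
next
  case (Suc k)
  have "Ck_on k U (pderiv_at i (\<lambda>y. B (f y) (g y)))" for i
    by (rule Ck_on_cong[OF assms(1) _ Ck_on_add[OF assms(1) Suc.IH[of f "pderiv_at i g"]
              Suc.IH[of "pderiv_at i f" g]]])
       (use Suc.prems Ck_on_Suc_imp in \<open>auto simp: pderiv_at_bounded_bilinear[OF assms(2)]\<close>)
  then show ?case using Suc.prems by (auto intro: differentiable_bounded_bilinear[OF assms(2)])
qed

lemma Ck_on_const: "Ck_on k U (\<lambda>y. c)"
proof (induction k arbitrary: c)
  case (Suc k)
  have "pderiv_at i (\<lambda>y. c) = (\<lambda>y. 0)" for i :: 'a by (simp add: fun_eq_iff)
  then show ?case using Suc by simp
qed simp

lemma smooth_on_differentiable: "smooth_on U f \<Longrightarrow> x \<in> U \<Longrightarrow> f differentiable (at x)"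
  unfolding smooth_on_def by (metis Ck_on.simps(2))

lemma smooth_on_pderiv_at: "smooth_on U f \<Longrightarrow> smooth_on U (pderiv_at i f)"
  unfolding smooth_on_def by (metis Ck_on.simps(2))

lemma smooth_on_cong:
  "open U \<Longrightarrow> (\<And>y. y \<in> U \<Longrightarrow> f y = g y) \<Longrightarrow> smooth_on U f \<Longrightarrow> smooth_on U g"
  unfolding smooth_on_def using Ck_on_cong by blast

lemma smooth_on_const: "smooth_on U (\<lambda>y. c)"
  unfolding smooth_on_def using Ck_on_const by blast

lemma smooth_on_add:
  "open U \<Longrightarrow> smooth_on U f \<Longrightarrow> smooth_on U g \<Longrightarrow> smooth_on U (\<lambda>y. f y + g y)"
  unfolding smooth_on_def using Ck_on_add by blast

lemma smooth_on_bounded_linear: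
  "open U \<Longrightarrow> bounded_linear L \<Longrightarrow> smooth_on U f \<Longrightarrow> smooth_on U (\<lambda>y. L (f y))"
  unfolding smooth_on_def using Ck_on_bounded_linear by blast

lemma smooth_on_bounded_bilinear:
  "open U \<Longrightarrow> bounded_bilinear B \<Longrightarrow> smooth_on U f \<Longrightarrow> smooth_on U g \<Longrightarrow>
    smooth_on U (\<lambda>y. B (f y) (g y))"
  unfolding smooth_on_def using Ck_on_bounded_bilinear by blast

lemma smooth_on_uminus: "open U \<Longrightarrow> smooth_on U f \<Longrightarrow> smooth_on U (\<lambda>y. - f y)"
  by (rule smooth_on_bounded_linear[OF _ bounded_linear_minus[OF bounded_linear_ident]])

lemma smooth_on_diff:
  "open U \<Longrightarrow> smooth_on U f \<Longrightarrow> smooth_on U g \<Longrightarrow> smooth_on U (\<lambda>y. f y - g y)"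
  using smooth_on_add[of U f "\<lambda>y. - g y"] smooth_on_uminus by auto

lemma smooth_on_sum:
  assumes "open U" "\<And>a. a \<in> I \<Longrightarrow> smooth_on U (f a)"
  shows "smooth_on U (\<lambda>y. \<Sum>a\<in>I. f a y)"
  using assms(2)
  by (induction I rule: infinite_finite_induct) (auto intro: smooth_on_const smooth_on_add assms(1))

lemma smooth_on_nth: "open U \<Longrightarrow> smooth_on U f \<Longrightarrow> smooth_on U (\<lambda>y. f y $ a)"
  by (rule smooth_on_bounded_linear[OF _ bounded_linear_vec_nth])

lemma vec_eq_sum_axis: "(\<chi> a. f a) = (\<Sum>a\<in>UNIV. axis a (f a))"
  by (simp add: vec_eq_iff axis_def sum.delta' if_distrib cong: if_cong)

lemma bounded_linear_axis: "bounded_linear (axis a :: 'b::euclidean_space \<Rightarrow> 'b^'n)"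
  by (intro linear_conv_bounded_linear[THEN iffD1] linearI) (auto simp: vec_eq_iff axis_def)

lemma smooth_on_vec_lambda:
  fixes f :: "'m::finite \<Rightarrow> real^'n \<Rightarrow> 'b::euclidean_space"
  assumes "open U" "\<And>a. smooth_on U (f a)"
  shows "smooth_on U (\<lambda>y. \<chi> a. f a y)"
  unfolding vec_eq_sum_axis
  by (intro smooth_on_sum smooth_on_bounded_linear[OF _ bounded_linear_axis] assms)

lemma bounded_bilinear_matrix_matrix_mult:
  "bounded_bilinear ((**) :: real^'n^'m \<Rightarrow> real^'k^'n \<Rightarrow> real^'k^'m)"
  unfolding bilinear_conv_bounded_bilinear[symmetric] bilinear_def
  by (auto intro!: linearI simp: matrix_matrix_mult_def vec_eq_iff sum.distrib algebra_simps
      sum_distrib_left)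

lemma bounded_bilinear_matrix_vector_mult:
  "bounded_bilinear ((*v) :: real^'n^'m \<Rightarrow> real^'n \<Rightarrow> real^'m)"
  unfolding bilinear_conv_bounded_bilinear[symmetric] bilinear_def
  by (auto intro!: linearI simp: matrix_vector_mult_def vec_eq_iff sum.distrib algebra_simps
      sum_distrib_left)

lemma bounded_linear_transpose: "bounded_linear (transpose :: real^'n^'m \<Rightarrow> real^'m^'n)"
  by (intro linear_conv_bounded_linear[THEN iffD1] linearI) (auto simp: vec_eq_iff transpose_def)

lemmas pderiv_at_matrix_mult = pderiv_at_bounded_bilinear[OF bounded_bilinear_matrix_matrix_mult]
lemmas pderiv_at_matrix_vector_mult = pderiv_at_bounded_bilinear[OF bounded_bilinear_matrix_vector_mult]
lemmas pderiv_at_transpose = pderiv_at_bounded_linear[OF bounded_linear_transpose]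


section \<open>Symmetry of second partial derivatives\<close>

lemma has_real_derivative_along_axis:
  fixes f :: "real^'n \<Rightarrow> real"
  assumes "f differentiable (at (y + u *\<^sub>R axis i 1))"
  shows "((\<lambda>u. f (y + u *\<^sub>R axis i 1)) has_real_derivative pderiv_at i f (y + u *\<^sub>R axis i 1)) (at u)"
proof -
  let ?D = "frechet_derivative f (at (y + u *\<^sub>R axis i 1))"
  have D: "(f has_derivative ?D) (at (y + u *\<^sub>R axis i 1))"
    using assms frechet_derivative_works by blast
  have "((\<lambda>u. y + u *\<^sub>R axis i 1) has_derivative (\<lambda>u. u *\<^sub>R axis i 1)) (at u)"
    by (auto intro!: derivative_eq_intros)
  from has_derivative_compose[OF this D]
  show ?thesis
    by (rule has_derivative_imp_has_field_derivative)
       (simp add: pderiv_at_def linear_cmul[OF has_derivative_linear[OF D]])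
qed

text \<open>The second difference of \<open>f\<close> over a square of side \<open>t\<close> does not depend on the order of \<open>i\<close> and
  \<open>j\<close>, while the point on the right-hand side does; letting \<open>t\<close> tend to \<open>0\<close> gives the symmetry.\<close>

lemma second_difference_mvt:
  fixes f :: "real^'n \<Rightarrow> real"
  assumes t: "t > 0" and C2: "Ck_on 2 U f"
    and box: "\<And>u v. 0 \<le> u \<Longrightarrow> u \<le> t \<Longrightarrow> 0 \<le> v \<Longrightarrow> v \<le> t \<Longrightarrow> x + u *\<^sub>R axis i 1 + v *\<^sub>R axis j 1 \<in> U"
  shows "\<exists>u v. 0 \<le> u \<and> u \<le> t \<and> 0 \<le> v \<and> v \<le> t \<and>
    f (x + t *\<^sub>R axis i 1 + t *\<^sub>R axis j 1) - f (x + t *\<^sub>R axis i 1) - f (x + t *\<^sub>R axis j 1) + f x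
      = t * (t * pderiv_at j (pderiv_at i f) (x + u *\<^sub>R axis i 1 + v *\<^sub>R axis j 1))"
proof -
  have df: "\<And>y. y \<in> U \<Longrightarrow> f differentiable (at y)"
    and ddf: "\<And>y i. y \<in> U \<Longrightarrow> pderiv_at i f differentiable (at y)"
    using C2 by (auto simp: numeral_2_eq_2)
  \<comment> \<open>apply the mean value theorem first in direction \<open>i\<close>, to the difference in direction \<open>j\<close>\<close>
  define p where "p u = f (x + t *\<^sub>R axis j 1 + u *\<^sub>R axis i 1) - f (x + u *\<^sub>R axis i 1)" for u
  have "\<exists>z. 0 < z \<and> z < t \<and> p t - p 0 = (t - 0) *
     (pderiv_at i f (x + t *\<^sub>R axis j 1 + z *\<^sub>R axis i 1) - pderiv_at i f (x + z *\<^sub>R axis i 1))"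
  proof (rule MVT2[OF t])
    fix u :: real assume u: "0 \<le> u" "u \<le> t"
    have "x + t *\<^sub>R axis j 1 + u *\<^sub>R axis i 1 \<in> U"
      using box[of u t] u t by (simp add: algebra_simps)
    moreover have "x + u *\<^sub>R axis i 1 \<in> U" using box[of u 0] u t by simp
    ultimately show "(p has_real_derivative pderiv_at i f (x + t *\<^sub>R axis j 1 + u *\<^sub>R axis i 1)
        - pderiv_at i f (x + u *\<^sub>R axis i 1)) (at u)"
      unfolding p_def[abs_def] by (intro DERIV_diff has_real_derivative_along_axis df)
  qed
  then obtain u where u: "0 < u" "u < t" "p t - p 0 = t *
     (pderiv_at i f (x + t *\<^sub>R axis j 1 + u *\<^sub>R axis i 1) - pderiv_at i f (x + u *\<^sub>R axis i 1))" by auto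
  have "\<exists>z. 0 < z \<and> z < t \<and> pderiv_at i f (x + u *\<^sub>R axis i 1 + t *\<^sub>R axis j 1)
        - pderiv_at i f (x + u *\<^sub>R axis i 1 + 0 *\<^sub>R axis j 1)
      = (t - 0) * pderiv_at j (pderiv_at i f) (x + u *\<^sub>R axis i 1 + z *\<^sub>R axis j 1)"
    by (rule MVT2[OF t]) (use box u in \<open>auto intro!: has_real_derivative_along_axis ddf\<close>)
  then obtain v where "0 < v" "v < t" "pderiv_at i f (x + u *\<^sub>R axis i 1 + t *\<^sub>R axis j 1)
        - pderiv_at i f (x + u *\<^sub>R axis i 1)
      = t * pderiv_at j (pderiv_at i f) (x + u *\<^sub>R axis i 1 + v *\<^sub>R axis j 1)" by auto
  with u show ?thesis
    unfolding p_def by (intro exI[of _ u] exI[of _ v]) (auto simp: algebra_simps)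
qed

lemma pderiv_at_commute_real:
  fixes f :: "real^'n \<Rightarrow> real"
  assumes "open U" "x \<in> U" and C2: "Ck_on 2 U f"
  shows "pderiv_at i (pderiv_at j f) x = pderiv_at j (pderiv_at i f) x"
proof -
  have close: "\<exists>d>0. \<forall>y. dist y x < d \<longrightarrow> \<bar>pderiv_at a (pderiv_at b f) y - pderiv_at a (pderiv_at b f) x\<bar> < e"
    if "e > 0" for a b e
  proof -
    have "continuous_on U (pderiv_at a (pderiv_at b f))" using C2 by (simp add: numeral_2_eq_2)
    then have "isCont (pderiv_at a (pderiv_at b f)) x"
      using assms continuous_on_eq_continuous_at by blast
    then show ?thesis using that by (auto simp: continuous_at dist_real_def)
        (metis (no_types) continuous_at_eps_delta dist_real_def \<open>isCont _ x\<close>)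
  qed
  have "\<bar>pderiv_at i (pderiv_at j f) x - pderiv_at j (pderiv_at i f) x\<bar> \<le> e" if e: "e > 0" for e
  proof -
    obtain r where r: "r > 0" "ball x r \<subseteq> U" using assms openE by blast
    obtain d1 where d1: "d1 > 0" "\<And>y. dist y x < d1 \<Longrightarrow>
        \<bar>pderiv_at i (pderiv_at j f) y - pderiv_at i (pderiv_at j f) x\<bar> < e/2"
      using close[of "e/2"] e by force
    obtain d2 where d2: "d2 > 0" "\<And>y. dist y x < d2 \<Longrightarrow>
        \<bar>pderiv_at j (pderiv_at i f) y - pderiv_at j (pderiv_at i f) x\<bar> < e/2"
      using close[of "e/2"] e by force
    define t where "t = min r (min d1 d2) / 3"
    have t: "t > 0" "2 * t < r" "2 * t < d1" "2 * t < d2" using r d1 d2 by (auto simp: t_def)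
    have near: "dist (x + u *\<^sub>R axis a 1 + v *\<^sub>R axis b 1) x \<le> 2 * t"
      if "0 \<le> u" "u \<le> t" "0 \<le> v" "v \<le> t" for u v and a b :: 'n
    proof -
      have "norm (u *\<^sub>R axis a (1::real) + v *\<^sub>R axis b 1) \<le> norm (u *\<^sub>R axis a (1::real)) + norm (v *\<^sub>R axis b (1::real))"
        by (rule norm_triangle_ineq)
      also have "\<dots> \<le> 2 * t" using that by simp
      finally show ?thesis by (simp add: dist_norm add.assoc)
    qed
    have box: "x + u *\<^sub>R axis a 1 + v *\<^sub>R axis b 1 \<in> U"
      if "0 \<le> u" "u \<le> t" "0 \<le> v" "v \<le> t" for u v and a b :: 'n
      using near[OF that, of a b] t r by (auto simp: subset_iff dist_commute)
    obtain u v where uv: "0 \<le> u" "u \<le> t" "0 \<le> v" "v \<le> t"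
      "f (x + t *\<^sub>R axis i 1 + t *\<^sub>R axis j 1) - f (x + t *\<^sub>R axis i 1) - f (x + t *\<^sub>R axis j 1) + f x
      = t * (t * pderiv_at j (pderiv_at i f) (x + u *\<^sub>R axis i 1 + v *\<^sub>R axis j 1))"
      using second_difference_mvt[OF t(1) C2 box, of i j] by auto
    obtain w z where wz: "0 \<le> w" "w \<le> t" "0 \<le> z" "z \<le> t"
      "f (x + t *\<^sub>R axis j 1 + t *\<^sub>R axis i 1) - f (x + t *\<^sub>R axis j 1) - f (x + t *\<^sub>R axis i 1) + f x
      = t * (t * pderiv_at i (pderiv_at j f) (x + w *\<^sub>R axis j 1 + z *\<^sub>R axis i 1))"
      using second_difference_mvt[OF t(1) C2 box, of j i] by auto
    have "t * (t * pderiv_at j (pderiv_at i f) (x + u *\<^sub>R axis i 1 + v *\<^sub>R axis j 1))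
        = t * (t * pderiv_at i (pderiv_at j f) (x + w *\<^sub>R axis j 1 + z *\<^sub>R axis i 1))"
      unfolding uv(5)[symmetric] wz(5)[symmetric] by (simp add: algebra_simps)
    then have "pderiv_at j (pderiv_at i f) (x + u *\<^sub>R axis i 1 + v *\<^sub>R axis j 1)
        = pderiv_at i (pderiv_at j f) (x + w *\<^sub>R axis j 1 + z *\<^sub>R axis i 1)"
      using t by simp
    moreover have "dist (x + u *\<^sub>R axis i 1 + v *\<^sub>R axis j 1) x < d2"
      using near[OF uv(1-4), of i j] t by simp
    moreover have "dist (x + w *\<^sub>R axis j 1 + z *\<^sub>R axis i 1) x < d1"
      using near[OF wz(1-4), of j i] t by simp
    ultimately show ?thesis using d1(2) d2(2) by (smt (verit) field_sum_of_halves)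
  qed
  then show ?thesis by (metis dense_ge abs_ge_zero abs_le_zero_iff eq_iff_diff_eq_0)
qed

lemma pderiv_at_commute:
  fixes f :: "real^'n \<Rightarrow> 'b::euclidean_space"
  assumes U: "open U" "x \<in> U" and f: "smooth_on U f"
  shows "pderiv_at i (pderiv_at j f) x = pderiv_at j (pderiv_at i f) x"
proof (rule euclidean_eqI)
  fix b :: 'b
  have in_inner: "pderiv_at i (\<lambda>y. h y \<bullet> b) y = pderiv_at i h y \<bullet> b"
    if "smooth_on U h" "y \<in> U" for h :: "real^'n \<Rightarrow> 'b" and i y
    by (rule pderiv_at_bounded_linear[OF bounded_linear_inner_left smooth_on_differentiable[OF that]])
  have two: "pderiv_at i (pderiv_at j (\<lambda>y. f y \<bullet> b)) x = pderiv_at i (pderiv_at j f) x \<bullet> b" for i j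
    using pderiv_at_cong[OF U, of "pderiv_at j (\<lambda>y. f y \<bullet> b)" "\<lambda>y. pderiv_at j f y \<bullet> b"]
      in_inner f smooth_on_pderiv_at U by metis
  have "Ck_on 2 U (\<lambda>y. f y \<bullet> b)"
    using smooth_on_bounded_linear[OF U(1) bounded_linear_inner_left f] by (auto simp: smooth_on_def)
  from pderiv_at_commute_real[OF U this, of i j]
  show "pderiv_at i (pderiv_at j f) x \<bullet> b = pderiv_at j (pderiv_at i f) x \<bullet> b"
    by (simp add: two)
qed


section \<open>Matrix-valued functions\<close>

interpretation matrix_mult: bounded_bilinear "(**) :: real^'n^'m \<Rightarrow> real^'k^'n \<Rightarrow> real^'k^'m"
  by (rule bounded_bilinear_matrix_matrix_mult)

lemmas matrix_ring_simps = matrix_mult.add_left matrix_mult.add_right matrix_mult.diff_left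
  matrix_mult.diff_right matrix_mult.minus_left matrix_mult.minus_right matrix_mul_assoc[symmetric]

lemmas transpose_add = linear_add[OF bounded_linear.linear[OF bounded_linear_transpose]]
lemmas transpose_diff = linear_diff[OF bounded_linear.linear[OF bounded_linear_transpose]]

lemma smooth_on_prod:
  fixes f :: "'i \<Rightarrow> real^'n \<Rightarrow> real"
  assumes "open U" "\<And>a. a \<in> I \<Longrightarrow> smooth_on U (f a)"
  shows "smooth_on U (\<lambda>y. \<Prod>a\<in>I. f a y)"
  using assms(2)
  by (induction I rule: infinite_finite_induct)
     (auto intro: smooth_on_const smooth_on_bounded_bilinear[OF assms(1) bounded_bilinear_mult])

lemma smooth_on_det:
  fixes f :: "real^'n \<Rightarrow> real^'m^'m"
  assumes "open U" "\<And>a b. smooth_on U (\<lambda>y. f y $ a $ b)"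
  shows "smooth_on U (\<lambda>y. det (f y))"
  unfolding det_def
  by (intro smooth_on_sum smooth_on_prod smooth_on_bounded_bilinear[OF assms(1) bounded_bilinear_mult]
      smooth_on_const assms)

lemma smooth_on_inverse:
  fixes f :: "real^'n \<Rightarrow> real"
  assumes U: "open U" and f: "smooth_on U f" and nz: "\<And>y. y \<in> U \<Longrightarrow> f y \<noteq> 0"
  shows "smooth_on U (\<lambda>y. inverse (f y))"
proof -
  have "Ck_on k U (\<lambda>y. inverse (f y))" for k
  proof (induction k)
    case 0
    have "continuous_on U f" using f by (metis smooth_on_def Ck_on.simps(1))
    then show ?case using nz by (auto intro: continuous_intros)
  next
    case (Suc k)
    have D: "((\<lambda>y. inverse (f y)) has_derivative
        (\<lambda>v. - (inverse (f x) * frechet_derivative f (at x) v * inverse (f x)))) (at x)" if "x \<in> U" for x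
      using Deriv.has_derivative_inverse[where f = f, OF nz[OF that]] smooth_on_differentiable[OF f that]
        frechet_derivative_works by blast
    have dinv: "pderiv_at i (\<lambda>y. inverse (f y)) x = - (inverse (f x) * pderiv_at i f x * inverse (f x))"
      if "x \<in> U" for x i
      using pderiv_at_has_derivative[OF D[OF that], of i] by (simp add: pderiv_at_def)
    have ck: "Ck_on k U (\<lambda>x. - (inverse (f x) * pderiv_at i f x * inverse (f x)))" for i
      using smooth_on_pderiv_at[OF f, of i] Suc
      by (intro Ck_on_bounded_linear[OF U bounded_linear_minus[OF bounded_linear_ident]]
          Ck_on_bounded_bilinear[OF U bounded_bilinear_mult]) (auto simp: smooth_on_def)
    have "Ck_on k U (pderiv_at i (\<lambda>y. inverse (f y)))" for i
      by (rule Ck_on_cong[OF U _ ck[of i]]) (simp add: dinv)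
    then show ?case using D by (auto simp: differentiable_def)
  qed
  then show ?thesis by (simp add: smooth_on_def)
qed

lemma matrix_inv_mult:
  fixes B :: "real^'n^'n"
  assumes "invertible B"
  shows "B ** matrix_inv B = mat 1" "matrix_inv B ** B = mat 1"
proof -
  have "\<exists>C. B ** C = mat 1 \<and> C ** B = mat 1" using assms by (simp add: invertible_def)
  from someI_ex[OF this] show "B ** matrix_inv B = mat 1" "matrix_inv B ** B = mat 1"
    by (simp_all add: matrix_inv_def)
qed

lemma matrix_inv_component_cramer:
  fixes B :: "real^'n^'n"
  assumes "invertible B"
  shows "matrix_inv B $ k $ l
    = det (\<chi> i j. if j = k then axis l 1 $ i else B $ i $ j) * inverse (det B)"
proof -
  have "B *v (matrix_inv B *v axis l 1) = axis l 1"
    by (simp add: matrix_vector_mul_assoc matrix_inv_mult[OF assms])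
  then have "matrix_inv B *v axis l 1
      = (\<chi> k. det (\<chi> i j. if j = k then axis l 1 $ i else B $ i $ j) / det B)"
    using cramer[of B] assms invertible_det_nz by blast
  then have "(matrix_inv B *v axis l 1) $ k
      = det (\<chi> i j. if j = k then axis l 1 $ i else B $ i $ j) / det B" by simp
  then show ?thesis
    by (simp add: matrix_vector_mult_basis column_def divide_inverse)
qed

lemma smooth_on_matrix_inv:
  fixes f :: "real^'n \<Rightarrow> real^'m^'m"
  assumes U: "open U" and f: "smooth_on U f" and inv: "\<And>y. y \<in> U \<Longrightarrow> invertible (f y)"
  shows "smooth_on U (\<lambda>y. matrix_inv (f y))"
proof -
  have det_nz: "det (f y) \<noteq> 0" if "y \<in> U" for y
    using inv[OF that] invertible_det_nz by blast
  have comp: "smooth_on U (\<lambda>y. f y $ a $ b)" for a b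
    by (intro smooth_on_nth U f)
  have "smooth_on U (\<lambda>y. if b = k then axis l 1 $ a else f y $ a $ b)" for a b k l
    by (cases "b = k") (auto intro: smooth_on_const comp)
  then have "smooth_on U (\<lambda>y. \<chi> k l. det (\<chi> i j. if j = k then axis l 1 $ i else f y $ i $ j)
      * inverse (det (f y)))"
    using det_nz
    by (intro smooth_on_vec_lambda U smooth_on_bounded_bilinear[OF U bounded_bilinear_mult]
        smooth_on_det smooth_on_inverse comp) simp_all
  then show ?thesis
    by (rule smooth_on_cong[OF U, rotated]) (simp add: vec_eq_iff matrix_inv_component_cramer inv)
qed

text \<open>The left-hand side is the trace of \<open>H P\<^sup>T\<close>. Only \<open>H\<close> needs to be symmetric. The induction
  removes one rank-one square \<open>c c\<^sup>T\<close> at a time from \<open>H\<close>, by completing the square.\<close>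

lemma sum_product_nonneg_of_positive_semidefinite:
  fixes H P :: "real^'n^'n"
  assumes "transpose H = H" "\<And>u. u \<bullet> (H *v u) \<ge> 0" and P: "\<And>u. u \<bullet> (P *v u) \<ge> 0"
  shows "(\<Sum>a\<in>UNIV. \<Sum>b\<in>UNIV. H $ a $ b * P $ a $ b) \<ge> 0"
  using assms(1,2)
proof (induction "card {a. H $ a $ a \<noteq> 0}" arbitrary: H rule: less_induct)
  case (less H)
  have sym: "H $ a $ b = H $ b $ a" for a b
    using arg_cong[OF less.prems(1), of "\<lambda>A. A $ b $ a"] by (simp add: transpose_def)
  have quad: "u \<bullet> (H *v u) = (\<Sum>a\<in>UNIV. \<Sum>b\<in>UNIV. H $ a $ b * (u $ a * u $ b))" for H :: "real^'n^'n" and u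
    by (simp add: inner_vec_def matrix_vector_mult_def sum_distrib_left mult_ac)
  have shift: "(u + t *\<^sub>R axis a 1) \<bullet> (H *v (u + t *\<^sub>R axis a 1))
      = u \<bullet> (H *v u) + 2 * t * (column a H \<bullet> u) + t\<^sup>2 * H $ a $ a" for u t a
  proof -
    have "axis a 1 \<bullet> (H *v u) = column a H \<bullet> u"
      unfolding inner_axis' by (simp add: matrix_vector_mult_def inner_vec_def column_def sym[of a])
    moreover have "axis a 1 \<bullet> (H *v axis a 1) = H $ a $ a"
      by (simp add: inner_axis' matrix_vector_mult_basis column_def)
    ultimately show ?thesis
      by (simp add: matrix_vector_right_distrib matrix_vector_mult_scaleR inner_add_left
          inner_add_right matrix_vector_mult_basis inner_commute[of u "column a H"]
          power2_eq_square algebra_simps)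
  qed
  show ?case
  proof (cases "\<exists>a. H $ a $ a \<noteq> 0")
    case False
    \<comment> \<open>a positive semidefinite matrix with zero diagonal vanishes\<close>
    have "H $ b $ a = 0" for a b
    proof (rule ccontr)
      assume nz: "H $ b $ a \<noteq> 0"
      have "0 \<le> axis b 1 \<bullet> (H *v axis b 1) + 2 * (- 1 / H $ b $ a) * (column a H \<bullet> axis b 1)
          + (- 1 / H $ b $ a)\<^sup>2 * H $ a $ a"
        using less.prems(2) shift by metis
      then show False using nz False
        by (simp add: matrix_vector_mult_basis inner_axis inner_axis' column_def)
    qed
    then show ?thesis by simp
  next
    case True
    then obtain a where a: "H $ a $ a \<noteq> 0" by blast
    define c where "c = column a H"
    have diag: "H $ b $ b \<ge> 0" for b
      using less.prems(2)[of "axis b 1"] by (simp add: matrix_vector_mult_basis inner_axis' column_def)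
    then have pos: "H $ a $ a > 0" using a by (simp add: less_le)
    define H' where "H' = (\<chi> i j. H $ i $ j - c $ i * c $ j / H $ a $ a)"
    have quad': "u \<bullet> (H' *v u) = u \<bullet> (H *v u) - (c \<bullet> u)\<^sup>2 / H $ a $ a" for u
      unfolding quad
      by (simp add: H'_def sum_subtractf inner_vec_def power2_eq_square sum_product
          sum_divide_distrib algebra_simps)
    \<comment> \<open>\<open>H'\<close> at \<open>u\<close> is the minimum of \<open>H\<close> along the line through \<open>u\<close> in direction \<open>a\<close>\<close>
    have psd: "u \<bullet> (H' *v u) \<ge> 0" for u
    proof -
      have "0 \<le> u \<bullet> (H *v u) + 2 * (- (c \<bullet> u) / H $ a $ a) * (c \<bullet> u) + (- (c \<bullet> u) / H $ a $ a)\<^sup>2 * H $ a $ a"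
        using less.prems(2) shift unfolding c_def by metis
      also have "\<dots> = u \<bullet> (H' *v u)"
        using pos by (simp add: quad' power2_eq_square field_simps)
      finally show ?thesis .
    qed
    have "{b. H' $ b $ b \<noteq> 0} \<subset> {b. H $ b $ b \<noteq> 0}"
    proof
      show "{b. H' $ b $ b \<noteq> 0} \<subseteq> {b. H $ b $ b \<noteq> 0}"
      proof clarify
        fix b assume b: "H' $ b $ b \<noteq> 0" "H $ b $ b = 0"
        have "H' $ b $ b \<ge> 0"
          using psd[of "axis b 1"] by (simp add: matrix_vector_mult_basis inner_axis' column_def)
        moreover have "H' $ b $ b \<le> 0" using b pos by (simp add: H'_def)
        ultimately show False using b by simp
      qed
      have "H' $ a $ a = 0" using pos by (simp add: H'_def c_def column_def)
      then show "{b. H' $ b $ b \<noteq> 0} \<noteq> {b. H $ b $ b \<noteq> 0}" using a by blast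
    qed
    then have "card {b. H' $ b $ b \<noteq> 0} < card {b. H $ b $ b \<noteq> 0}"
      by (intro psubset_card_mono) auto
    moreover have "transpose H' = H'"
      by (simp add: H'_def transpose_def vec_eq_iff sym mult.commute)
    ultimately have "(\<Sum>i\<in>UNIV. \<Sum>j\<in>UNIV. H' $ i $ j * P $ i $ j) \<ge> 0"
      using less.hyps psd by blast
    moreover have "(\<Sum>i\<in>UNIV. \<Sum>j\<in>UNIV. H $ i $ j * P $ i $ j)
        = (\<Sum>i\<in>UNIV. \<Sum>j\<in>UNIV. H' $ i $ j * P $ i $ j) + (c \<bullet> (P *v c)) / H $ a $ a"
      unfolding quad
      by (simp add: H'_def sum_divide_distrib flip: sum.distrib) (simp add: algebra_simps)
    ultimately show ?thesis using P[of c] pos by simp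
  qed
qed


section \<open>Riemannian metrics in a coordinate domain\<close>

text \<open>A Riemannian metric given by its matrix \<open>G\<close> in one coordinate domain \<open>U\<close>.\<close>

locale metric_domain =
  fixes U :: "(real^'n::finite) set" and G :: "real^'n \<Rightarrow> real^'n^'n"
  assumes open_domain: "open U"
    and smooth_metric: "smooth_on U G"
    and metric_sym: "x \<in> U \<Longrightarrow> transpose (G x) = G x"
    and metric_pos_def: "x \<in> U \<Longrightarrow> V \<noteq> 0 \<Longrightarrow> bilin (G x) V V > 0"
begin

text \<open>The inverse metric \<open>g\<^sup>k\<^sup>l\<close>.\<close>

definition Ginv :: "real^'n \<Rightarrow> real^'n^'n"
  where "Ginv x = matrix_inv (G x)"

text \<open>The connection matrix in direction \<open>i\<close>: the row is the upper index of the Christoffel symbol and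
  the column the lower index that acts on a vector, so that \<open>\<nabla>\<^sub>i Y = \<partial>\<^sub>i Y + \<Gamma>\<^sub>i Y\<close>.\<close>

definition Gam :: "'n \<Rightarrow> real^'n \<Rightarrow> real^'n^'n"
  where "Gam i x = (\<chi> k j. christoffel G k i j x)"

lemma invertible_metric: "x \<in> U \<Longrightarrow> invertible (G x)"
  using metric_pos_def[of x] unfolding invertible_left_inverse matrix_left_invertible_ker bilin_def
  by fastforce

lemma metric_mult_inverse: "x \<in> U \<Longrightarrow> G x ** Ginv x = mat 1" "x \<in> U \<Longrightarrow> Ginv x ** G x = mat 1"
  unfolding Ginv_def by (auto simp: matrix_inv_mult invertible_metric)

lemma inverse_metric_sym: assumes "x \<in> U" shows "transpose (Ginv x) = Ginv x"
proof -
  have "transpose (Ginv x) ** G x = mat 1"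
    using arg_cong[OF metric_mult_inverse(1)[OF assms], of transpose]
    by (simp add: matrix_transpose_mul metric_sym assms)
  then have "transpose (Ginv x) ** (G x ** Ginv x) = Ginv x"
    by (simp add: matrix_mul_assoc)
  then show ?thesis by (simp add: metric_mult_inverse assms)
qed

lemma inverse_metric_nonneg:
  assumes x: "x \<in> U"
  shows "u \<bullet> (Ginv x *v u) \<ge> 0"
proof -
  have "u = G x *v (Ginv x *v u)"
    by (simp add: matrix_vector_mul_assoc metric_mult_inverse x)
  then have "u \<bullet> (Ginv x *v u) = bilin (G x) (Ginv x *v u) (Ginv x *v u)"
    unfolding bilin_def by (metis inner_commute)
  moreover have "bilin (G x) v v \<ge> 0" for v
    using metric_pos_def[OF x, of v] by (cases "v = 0") (auto simp: bilin_def)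
  ultimately show ?thesis by simp
qed

lemma smooth_inverse_metric: "smooth_on U Ginv"
  using smooth_on_matrix_inv[OF open_domain smooth_metric invertible_metric]
  by (simp add: Ginv_def[abs_def])

text \<open>The Christoffel symbols of the first kind, with the lowered index as the row.\<close>

definition Gam_low :: "'n \<Rightarrow> real^'n \<Rightarrow> real^'n^'n"
  where "Gam_low i x = (\<chi> l j. 1/2 * (pderiv_at i (\<lambda>y. G y $ j $ l) x
    + pderiv_at j (\<lambda>y. G y $ i $ l) x - pderiv_at l (\<lambda>y. G y $ i $ j) x))"

lemma Gam_eq: "Gam i x = Ginv x ** Gam_low i x"
  by (simp add: Gam_def Gam_low_def vec_eq_iff christoffel_def Ginv_def matrix_matrix_mult_def
      sum_distrib_left mult_ac)

lemma smooth_Gam: "smooth_on U (Gam i)"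
proof -
  have "smooth_on U (Gam_low i)"
    unfolding Gam_low_def[abs_def]
    by (intro smooth_on_vec_lambda smooth_on_bounded_bilinear[OF open_domain bounded_bilinear_mult]
        smooth_on_const smooth_on_add smooth_on_diff smooth_on_pderiv_at smooth_on_nth
        open_domain smooth_metric)
  then show ?thesis
    unfolding Gam_eq[abs_def]
    by (intro smooth_on_bounded_bilinear[OF open_domain bounded_bilinear_matrix_matrix_mult]
        smooth_inverse_metric)
qed

lemmas differentiable_metric = smooth_on_differentiable[OF smooth_metric]
lemmas differentiable_inverse_metric = smooth_on_differentiable[OF smooth_inverse_metric]
lemmas differentiable_Gam = smooth_on_differentiable[OF smooth_Gam]
lemmas differentiable_pderiv_Gam = smooth_on_differentiable[OF smooth_on_pderiv_at[OF smooth_Gam]]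

lemma pderiv_metric_sym:
  assumes "x \<in> U"
  shows "pderiv_at i (\<lambda>y. G y $ a $ b) x = pderiv_at i (\<lambda>y. G y $ b $ a) x"
proof (rule pderiv_at_cong[OF open_domain assms])
  fix y assume "y \<in> U"
  from metric_sym[OF this] show "G y $ a $ b = G y $ b $ a"
    by (metis transpose_def vec_lambda_beta)
qed

lemma Gam_sym: "x \<in> U \<Longrightarrow> Gam i x $ k $ j = Gam j x $ k $ i"
  using pderiv_metric_sym[of x _ i j] by (simp add: Gam_def christoffel_def algebra_simps)

text \<open>The connection is metric, \<open>\<nabla>g = 0\<close>; hence also \<open>\<nabla>g\<^sup>-\<^sup>1 = 0\<close>, in \<open>pderiv_inverse_metric\<close>.\<close>

lemma pderiv_metric:
  assumes x: "x \<in> U"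
  shows "pderiv_at i G x = transpose (Gam i x) ** G x + G x ** Gam i x"
proof -
  have low: "G x ** Gam i x = Gam_low i x"
    by (simp add: Gam_eq matrix_mul_assoc metric_mult_inverse x)
  have "transpose (Gam i x) ** G x = transpose (Gam_low i x)"
    using arg_cong[OF low, of transpose] by (simp add: matrix_transpose_mul metric_sym x)
  moreover have "transpose (Gam_low i x) + Gam_low i x = pderiv_at i G x"
  proof -
    have "(transpose (Gam_low i x) + Gam_low i x) $ a $ b = pderiv_at i G x $ a $ b" for a b
      using pderiv_metric_sym[OF x, of i a b] pderiv_metric_sym[OF x, of a i b]
        pderiv_metric_sym[OF x, of b i a] pderiv_at_nth2[OF differentiable_metric[OF x], of i a b]
      by (simp add: Gam_low_def transpose_def field_simps)
    then show ?thesis by (simp add: vec_eq_iff)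
  qed
  ultimately show ?thesis using low by simp
qed

lemma pderiv_inverse_metric:
  assumes x: "x \<in> U"
  shows "pderiv_at i Ginv x = - (Gam i x ** Ginv x) - Ginv x ** transpose (Gam i x)"
proof -
  have "0 = pderiv_at i (\<lambda>y. mat 1 :: real^'n^'n) x" by simp
  also have "\<dots> = pderiv_at i (\<lambda>y. Ginv y ** G y) x"
    by (rule pderiv_at_cong[OF open_domain x]) (simp add: metric_mult_inverse)
  also have "\<dots> = Ginv x ** pderiv_at i G x + pderiv_at i Ginv x ** G x"
    by (rule pderiv_at_matrix_mult[OF differentiable_inverse_metric[OF x] differentiable_metric[OF x]])
  finally have "(Ginv x ** pderiv_at i G x + pderiv_at i Ginv x ** G x) ** Ginv x = 0" by simp
  then have "Ginv x ** (transpose (Gam i x) ** (G x ** Ginv x)) + (Ginv x ** G x) ** (Gam i x ** Ginv x)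
      + pderiv_at i Ginv x ** (G x ** Ginv x) = 0"
    by (simp add: pderiv_metric x matrix_ring_simps)
  then show ?thesis
    by (simp add: metric_mult_inverse x eq_neg_iff_add_eq_0 algebra_simps)
qed


section \<open>Curvature and the second Bianchi identity\<close>

text \<open>The curvature endomorphism \<open>R(\<partial>\<^sub>i,\<partial>\<^sub>j)\<close>, as the curvature of the matrix-valued 1-form \<open>\<Gamma>\<close>.\<close>

definition Rm :: "'n \<Rightarrow> 'n \<Rightarrow> real^'n \<Rightarrow> real^'n^'n"
  where "Rm i j x = pderiv_at i (Gam j) x - pderiv_at j (Gam i) x
    + Gam i x ** Gam j x - Gam j x ** Gam i x"

lemma Rm_antisym: "Rm j i x = - Rm i j x"
  by (simp add: Rm_def)

lemma smooth_Rm: "smooth_on U (Rm i j)"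
  unfolding Rm_def[abs_def]
  by (intro smooth_on_diff smooth_on_add smooth_on_pderiv_at smooth_Gam open_domain
      smooth_on_bounded_bilinear[OF open_domain bounded_bilinear_matrix_matrix_mult])

lemma pderiv_Rm:
  assumes x: "x \<in> U"
  shows "pderiv_at k (Rm i j) x = pderiv_at k (pderiv_at i (Gam j)) x - pderiv_at k (pderiv_at j (Gam i)) x
    + (Gam i x ** pderiv_at k (Gam j) x + pderiv_at k (Gam i) x ** Gam j x)
    - (Gam j x ** pderiv_at k (Gam i) x + pderiv_at k (Gam j) x ** Gam i x)"
  unfolding Rm_def[abs_def]
  by (simp add: pderiv_at_add pderiv_at_diff pderiv_at_matrix_mult differentiable_add differentiable_diff
      differentiable_Gam[OF x] differentiable_pderiv_Gam[OF x]
      differentiable_bounded_bilinear[OF bounded_bilinear_matrix_matrix_mult])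

text \<open>The terms with Christoffel symbols in the form indices \<open>i, j, k\<close> are absent because they cancel in
  the cyclic sum, the connection being free of torsion.\<close>

lemma second_bianchi:
  assumes x: "x \<in> U"
  shows "(pderiv_at i (Rm j k) x + Gam i x ** Rm j k x - Rm j k x ** Gam i x)
    + (pderiv_at j (Rm k i) x + Gam j x ** Rm k i x - Rm k i x ** Gam j x)
    + (pderiv_at k (Rm i j) x + Gam k x ** Rm i j x - Rm i j x ** Gam k x) = 0"
proof -
  have com: "pderiv_at a (pderiv_at b (Gam c)) x = pderiv_at b (pderiv_at a (Gam c)) x" for a b c
    by (rule pderiv_at_commute[OF open_domain x smooth_Gam])
  show ?thesis
    unfolding pderiv_Rm[OF x] Rm_def com[of j i] com[of k i] com[of k j]
    by (simp add: matrix_ring_simps)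
qed

text \<open>The curvature \<open>R\<^sub>i\<^sub>j\<^sup>a\<^sup>b\<close> with its lower endomorphism index raised, so that \<open>a\<close> and \<open>b\<close> are both upper indices.\<close>

definition Rm_up :: "'n \<Rightarrow> 'n \<Rightarrow> real^'n \<Rightarrow> real^'n^'n"
  where "Rm_up i j x = Rm i j x ** Ginv x"

lemma smooth_Rm_up: "smooth_on U (Rm_up i j)"
  unfolding Rm_up_def[abs_def]
  by (intro smooth_on_bounded_bilinear[OF open_domain bounded_bilinear_matrix_matrix_mult]
      smooth_Rm smooth_inverse_metric)

lemma Rm_up_antisym: "Rm_up j i x = - Rm_up i j x"
  by (simp add: Rm_up_def Rm_antisym[of j i] matrix_ring_simps)

text \<open>This is the equality of the mixed second derivatives of the inverse metric, each of which is
  expressed through \<open>\<nabla>g\<^sup>-\<^sup>1 = 0\<close>.\<close>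

lemma Rm_up_skew:
  assumes x: "x \<in> U"
  shows "transpose (Rm_up i j x) = - Rm_up i j x"
proof -
  have dd: "pderiv_at a (pderiv_at b Ginv) x
     = - (Gam b x ** pderiv_at a Ginv x + pderiv_at a (Gam b) x ** Ginv x)
       - (Ginv x ** transpose (pderiv_at a (Gam b) x) + pderiv_at a Ginv x ** transpose (Gam b x))" for a b
  proof -
    have "pderiv_at a (pderiv_at b Ginv) x
        = pderiv_at a (\<lambda>y. - (Gam b y ** Ginv y) - Ginv y ** transpose (Gam b y)) x"
      by (rule pderiv_at_cong[OF open_domain x]) (simp add: pderiv_inverse_metric)
    also have "\<dots> = - (Gam b x ** pderiv_at a Ginv x + pderiv_at a (Gam b) x ** Ginv x)
       - (Ginv x ** transpose (pderiv_at a (Gam b) x) + pderiv_at a Ginv x ** transpose (Gam b x))"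
      by (simp add: pderiv_at_diff pderiv_at_uminus pderiv_at_matrix_mult pderiv_at_transpose
        differentiable_Gam[OF x] differentiable_inverse_metric[OF x]
        differentiable_bounded_linear[OF bounded_linear_transpose]
        differentiable_bounded_bilinear[OF bounded_bilinear_matrix_matrix_mult])
    finally show ?thesis .
  qed
  have "pderiv_at i (pderiv_at j Ginv) x = pderiv_at j (pderiv_at i Ginv) x"
    by (rule pderiv_at_commute[OF open_domain x smooth_inverse_metric])
  then have "Rm i j x ** Ginv x + Ginv x ** transpose (Rm i j x) = 0"
    unfolding dd pderiv_inverse_metric[OF x] Rm_def
    by (simp add: matrix_ring_simps transpose_add transpose_diff matrix_transpose_mul algebra_simps)
  then show ?thesis
    by (simp add: Rm_up_def matrix_transpose_mul inverse_metric_sym x eq_neg_iff_add_eq_0 algebra_simps)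
qed

lemma pderiv_Rm_up:
  assumes x: "x \<in> U"
  shows "pderiv_at i (Rm_up j k) x + Gam i x ** Rm_up j k x + Rm_up j k x ** transpose (Gam i x)
    = (pderiv_at i (Rm j k) x + Gam i x ** Rm j k x - Rm j k x ** Gam i x) ** Ginv x"
proof -
  have "pderiv_at i (Rm_up j k) x = Rm j k x ** pderiv_at i Ginv x + pderiv_at i (Rm j k) x ** Ginv x"
    unfolding Rm_up_def[abs_def]
    by (rule pderiv_at_matrix_mult[OF smooth_on_differentiable[OF smooth_Rm x]
        differentiable_inverse_metric[OF x]])
  then show ?thesis
    by (simp add: pderiv_inverse_metric x Rm_up_def matrix_ring_simps)
qed

text \<open>The covariant derivative of \<open>R\<^sub>j\<^sub>k\<^sup>a\<^sup>b\<close> in direction \<open>i\<close> with respect to the upper indices only; the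
  corrections for \<open>j\<close> and \<open>k\<close> cancel in the Bianchi identity.\<close>

definition nabla_Rm_up :: "'n \<Rightarrow> 'n \<Rightarrow> 'n \<Rightarrow> real^'n \<Rightarrow> real^'n^'n"
  where "nabla_Rm_up i j k x = pderiv_at i (Rm_up j k) x + Gam i x ** Rm_up j k x + Rm_up j k x ** transpose (Gam i x)"

lemma second_bianchi_raised:
  "x \<in> U \<Longrightarrow> nabla_Rm_up i j k x + nabla_Rm_up j k i x + nabla_Rm_up k i j x = 0"
  unfolding nabla_Rm_up_def pderiv_Rm_up matrix_mult.add_left[symmetric] second_bianchi by simp

text \<open>The Ricci tensor \<open>Ric\<^sub>k\<^sup>m\<close> with its second index raised. It is defined by contracting the
  curvature; that it comes from \<open>ricci G\<close> is \<open>ricci_mixed_eq\<close>.\<close>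

definition ricci_mixed :: "'n \<Rightarrow> 'n \<Rightarrow> real^'n \<Rightarrow> real"
  where "ricci_mixed k m x = (\<Sum>j\<in>UNIV. Rm_up j k x $ j $ m)"

lemma nabla_Rm_up_antisym:
  assumes x: "x \<in> U"
  shows "nabla_Rm_up i k j x = - nabla_Rm_up i j k x"
proof -
  have "Rm_up k j = (\<lambda>y. - Rm_up j k y)" by (intro ext Rm_up_antisym)
  then have d: "pderiv_at i (Rm_up k j) x = - pderiv_at i (Rm_up j k) x"
    by (simp add: pderiv_at_uminus[OF smooth_on_differentiable[OF smooth_Rm_up x]])
  show ?thesis unfolding nabla_Rm_up_def d Rm_up_antisym[of k j x] by (simp add: matrix_ring_simps)
qed

lemma nabla_Rm_up_skew:
  assumes x: "x \<in> U"
  shows "nabla_Rm_up i j k x $ b $ a = - nabla_Rm_up i j k x $ a $ b"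
proof -
  have "pderiv_at i (\<lambda>y. transpose (Rm_up j k y)) x = pderiv_at i (\<lambda>y. - Rm_up j k y) x"
    by (rule pderiv_at_cong[OF open_domain x]) (rule Rm_up_skew)
  then have "transpose (pderiv_at i (Rm_up j k) x) = - pderiv_at i (Rm_up j k) x"
    by (simp add: pderiv_at_uminus pderiv_at_transpose smooth_on_differentiable[OF smooth_Rm_up x])
  then have "transpose (nabla_Rm_up i j k x) = - nabla_Rm_up i j k x"
    by (simp add: nabla_Rm_up_def transpose_add matrix_transpose_mul Rm_up_skew[OF x] matrix_ring_simps)
  from arg_cong[OF this, of "\<lambda>A. A $ a $ b"] show ?thesis by (simp add: transpose_def)
qed

lemma Rm_up_skew_component: "x \<in> U \<Longrightarrow> Rm_up i j x $ b $ a = - Rm_up i j x $ a $ b"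
  using arg_cong[OF Rm_up_skew, of x "\<lambda>A. A $ a $ b" i j] by (simp add: transpose_def)

lemma pderiv_ricci_mixed:
  assumes x: "x \<in> U"
  shows "pderiv_at i (ricci_mixed k m) x = (\<Sum>j\<in>UNIV. pderiv_at i (Rm_up j k) x $ j $ m)"
  unfolding ricci_mixed_def[abs_def]
  by (simp add: pderiv_at_sum pderiv_at_nth2 smooth_on_differentiable[OF smooth_on_nth[OF open_domain
        smooth_on_nth[OF open_domain smooth_Rm_up]] x] smooth_on_differentiable[OF smooth_Rm_up x])

lemma smooth_ricci_mixed: "smooth_on U (ricci_mixed k m)"
  unfolding ricci_mixed_def[abs_def] by (intro smooth_on_sum smooth_on_nth open_domain smooth_Rm_up)

text \<open>The identity \<open>2 \<nabla>\<^sub>i Ric\<^sub>k\<^sup>i = \<partial>\<^sub>k scal\<close>, written out with Christoffel symbols.\<close>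

lemma contracted_bianchi:
  assumes x: "x \<in> U"
  shows "2 * ((\<Sum>i\<in>UNIV. pderiv_at i (ricci_mixed k i) x) + (\<Sum>m\<in>UNIV. \<Sum>i\<in>UNIV. ricci_mixed k m x * Gam i x $ i $ m))
    = pderiv_at k (\<lambda>y. \<Sum>j\<in>UNIV. ricci_mixed j j y) x + 2 * (\<Sum>j\<in>UNIV. \<Sum>m\<in>UNIV. Gam k x $ j $ m * ricci_mixed j m x)"
proof -
  let ?N = "\<lambda>i j k a b. nabla_Rm_up i j k x $ a $ b"
  have comp: "?N i j k a b = pderiv_at i (Rm_up j k) x $ a $ b
      + (\<Sum>m\<in>UNIV. Gam i x $ a $ m * Rm_up j k x $ m $ b) + (\<Sum>m\<in>UNIV. Rm_up j k x $ a $ m * Gam i x $ b $ m)"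
    for i j k a b
    by (simp add: nabla_Rm_up_def matrix_matrix_mult_def transpose_def)
  have cyc: "?N i j k i j + ?N j k i i j + ?N k i j i j = 0" for i j
    using arg_cong[OF second_bianchi_raised[OF x, of i j k], of "\<lambda>A. A $ i $ j"] by simp
  have swap: "?N j k i i j = ?N j i k j i" for i j
    using nabla_Rm_up_antisym[OF x, of j k i] nabla_Rm_up_skew[OF x, of j i k j i] by simp
  \<comment> \<open>contract the second Bianchi identity with \<open>i\<close> and \<open>j\<close> as upper indices; by skew symmetry in
    both pairs of indices, its first two terms contract to the same sum \<open>T\<close>\<close>
  define T where "T = (\<Sum>i\<in>UNIV. \<Sum>j\<in>UNIV. ?N i j k i j)"
  define W where "W = (\<Sum>i\<in>UNIV. \<Sum>j\<in>UNIV. ?N k i j i j)"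
  have "(\<Sum>i\<in>UNIV. \<Sum>j\<in>UNIV. ?N j k i i j) = T"
    unfolding T_def swap by (rule sum.swap)
  moreover have "T + (\<Sum>i\<in>UNIV. \<Sum>j\<in>UNIV. ?N j k i i j) + W = 0"
    by (simp add: T_def W_def cyc flip: sum.distrib)
  ultimately have TW: "2 * T + W = 0" by simp
  \<comment> \<open>\<open>\<Gamma>\<^sup>j\<^sub>i\<^sub>m\<close> is symmetric in \<open>i\<close> and \<open>m\<close>, the curvature is skew in them\<close>
  have Z: "(\<Sum>i\<in>UNIV. \<Sum>j\<in>UNIV. \<Sum>m\<in>UNIV. Gam i x $ j $ m * Rm_up j k x $ m $ i) = 0" (is "?z = 0")
  proof -
    have "?z = (\<Sum>j\<in>UNIV. \<Sum>i\<in>UNIV. \<Sum>m\<in>UNIV. Gam i x $ j $ m * Rm_up j k x $ m $ i)"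
      by (rule sum.swap)
    also have "\<dots> = (\<Sum>j\<in>UNIV. \<Sum>m\<in>UNIV. \<Sum>i\<in>UNIV. Gam i x $ j $ m * Rm_up j k x $ m $ i)"
      by (intro sum.cong refl sum.swap)
    also have "\<dots> = (\<Sum>j\<in>UNIV. \<Sum>m\<in>UNIV. \<Sum>i\<in>UNIV. - (Gam m x $ j $ i * Rm_up j k x $ i $ m))"
    proof (intro sum.cong refl)
      fix j m i
      show "Gam i x $ j $ m * Rm_up j k x $ m $ i = - (Gam m x $ j $ i * Rm_up j k x $ i $ m)"
        using Gam_sym[OF x, of i j m] Rm_up_skew_component[OF x, of j k m i] by simp
    qed
    also have "\<dots> = - (\<Sum>j\<in>UNIV. \<Sum>m\<in>UNIV. \<Sum>i\<in>UNIV. Gam m x $ j $ i * Rm_up j k x $ i $ m)"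
      by (simp add: sum_negf)
    also have "\<dots> = - ?z" by (subst sum.swap) simp
    finally show ?thesis by simp
  qed
  have "T = - (\<Sum>i\<in>UNIV. \<Sum>j\<in>UNIV. ?N i j k j i)"
    unfolding T_def sum_negf[symmetric] by (intro sum.cong refl nabla_Rm_up_skew[OF x])
  also have "\<dots> = - ((\<Sum>i\<in>UNIV. pderiv_at i (ricci_mixed k i) x) + (\<Sum>m\<in>UNIV. \<Sum>i\<in>UNIV. ricci_mixed k m x * Gam i x $ i $ m))"
  proof -
    have "(\<Sum>i\<in>UNIV. \<Sum>j\<in>UNIV. \<Sum>m\<in>UNIV. Rm_up j k x $ j $ m * Gam i x $ i $ m)
        = (\<Sum>i\<in>UNIV. \<Sum>m\<in>UNIV. ricci_mixed k m x * Gam i x $ i $ m)"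
      unfolding ricci_mixed_def sum_distrib_right by (intro sum.cong refl sum.swap)
    also have "\<dots> = (\<Sum>m\<in>UNIV. \<Sum>i\<in>UNIV. ricci_mixed k m x * Gam i x $ i $ m)" by (rule sum.swap)
    finally show ?thesis
      unfolding comp pderiv_ricci_mixed[OF x] using Z by (simp add: sum.distrib)
  qed
  finally have T: "T = - ((\<Sum>i\<in>UNIV. pderiv_at i (ricci_mixed k i) x) + (\<Sum>m\<in>UNIV. \<Sum>i\<in>UNIV. ricci_mixed k m x * Gam i x $ i $ m))" .
  have W: "W = pderiv_at k (\<lambda>y. \<Sum>j\<in>UNIV. ricci_mixed j j y) x + 2 * (\<Sum>j\<in>UNIV. \<Sum>m\<in>UNIV. Gam k x $ j $ m * ricci_mixed j m x)"
  proof -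
    have "pderiv_at k (\<lambda>y. \<Sum>j\<in>UNIV. ricci_mixed j j y) x = (\<Sum>j\<in>UNIV. \<Sum>i\<in>UNIV. pderiv_at k (Rm_up i j) x $ i $ j)"
      by (simp add: pderiv_at_sum smooth_on_differentiable[OF smooth_ricci_mixed x] pderiv_ricci_mixed[OF x])
    also have "\<dots> = (\<Sum>i\<in>UNIV. \<Sum>j\<in>UNIV. pderiv_at k (Rm_up i j) x $ i $ j)" by (rule sum.swap)
    finally have 1: "(\<Sum>i\<in>UNIV. \<Sum>j\<in>UNIV. pderiv_at k (Rm_up i j) x $ i $ j)
      = pderiv_at k (\<lambda>y. \<Sum>j\<in>UNIV. ricci_mixed j j y) x" by simp
    have flip: "Rm_up i j x $ m $ j = Rm_up j i x $ j $ m" for i j m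
      using Rm_up_antisym[of i j x] Rm_up_skew_component[OF x, of j i j m] by simp
    have 2: "(\<Sum>i\<in>UNIV. \<Sum>j\<in>UNIV. \<Sum>m\<in>UNIV. Gam k x $ i $ m * Rm_up i j x $ m $ j)
      = (\<Sum>i\<in>UNIV. \<Sum>m\<in>UNIV. Gam k x $ i $ m * ricci_mixed i m x)"
    proof (rule sum.cong[OF refl])
      fix i
      have "(\<Sum>j\<in>UNIV. \<Sum>m\<in>UNIV. Gam k x $ i $ m * Rm_up i j x $ m $ j)
        = (\<Sum>j\<in>UNIV. \<Sum>m\<in>UNIV. Gam k x $ i $ m * Rm_up j i x $ j $ m)"
        by (intro sum.cong refl arg_cong2[of _ _ _ _ "(*)"] flip)
      also have "\<dots> = (\<Sum>m\<in>UNIV. Gam k x $ i $ m * ricci_mixed i m x)"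
        unfolding ricci_mixed_def sum_distrib_left by (rule sum.swap)
      finally show "(\<Sum>j\<in>UNIV. \<Sum>m\<in>UNIV. Gam k x $ i $ m * Rm_up i j x $ m $ j)
        = (\<Sum>m\<in>UNIV. Gam k x $ i $ m * ricci_mixed i m x)" .
    qed
    have "(\<Sum>i\<in>UNIV. \<Sum>j\<in>UNIV. \<Sum>m\<in>UNIV. Rm_up i j x $ i $ m * Gam k x $ j $ m)
      = (\<Sum>j\<in>UNIV. \<Sum>i\<in>UNIV. \<Sum>m\<in>UNIV. Gam k x $ j $ m * Rm_up i j x $ i $ m)"
      by (subst sum.swap) (simp add: mult.commute)
    also have "\<dots> = (\<Sum>j\<in>UNIV. \<Sum>m\<in>UNIV. Gam k x $ j $ m * ricci_mixed j m x)"
      unfolding ricci_mixed_def sum_distrib_left by (intro sum.cong refl sum.swap)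
    finally show ?thesis
      unfolding W_def comp using 1 2 by (simp add: sum.distrib)
  qed
  show ?thesis using TW unfolding T W by simp
qed


section \<open>Comparison with the curvature of coordinate fields\<close>

lemma levi_civita_coord:
  "levi_civita G (coord_field i) Y x = pderiv_at i Y x + Gam i x *v Y x"
proof -
  have "(\<Sum>a\<in>UNIV. axis i 1 $ a *\<^sub>R pderiv_at a Y x) = pderiv_at i Y x"
    by (simp add: axis_def if_distrib if_distribR sum.delta cong: if_cong)
  moreover have "(\<Sum>a\<in>UNIV. \<Sum>j\<in>UNIV. christoffel G k a j x * (axis i 1 $ a) * (Y x $ j))
      = (Gam i x *v Y x) $ k" for k
  proof -
    have "(\<Sum>a\<in>UNIV. \<Sum>j\<in>UNIV. christoffel G k a j x * (axis i 1 $ a) * (Y x $ j))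
      = (\<Sum>a\<in>UNIV. if a = i then \<Sum>j\<in>UNIV. christoffel G k a j x * (Y x $ j) else 0)"
      by (intro sum.cong refl) (auto simp: axis_def)
    then show ?thesis by (simp add: Gam_def matrix_vector_mult_def)
  qed
  ultimately show ?thesis
    by (simp add: levi_civita_def dir_deriv_def coord_field_def vec_eq_iff)
qed

lemma curvature_coord:
  assumes x: "x \<in> U"
  shows "curvature G (coord_field i) (coord_field j) (coord_field k) x = Rm i j x *v axis k 1"
proof -
  have lie: "lie_bracket (coord_field i) (coord_field j) x = 0"
    by (simp add: lie_bracket_def dir_deriv_def coord_field_def)
  have "levi_civita G (lie_bracket (coord_field i) (coord_field j)) (coord_field k) x = 0"
    by (simp add: levi_civita_def dir_deriv_def lie vec_eq_iff)
  moreover have "levi_civita G (coord_field i) (levi_civita G (coord_field j) (coord_field k)) x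
      = (pderiv_at i (Gam j) x + Gam i x ** Gam j x) *v axis k 1" for i j
  proof -
    have "levi_civita G (coord_field j) (coord_field k) = (\<lambda>y. Gam j y *v axis k 1)"
      by (rule ext, unfold levi_civita_coord, simp add: coord_field_def)
    then show ?thesis
      by (simp add: levi_civita_coord pderiv_at_matrix_vector_mult differentiable_Gam[OF x]
          matrix_vector_mul_assoc matrix_vector_mult_add_rdistrib)
  qed
  ultimately show ?thesis
    by (simp add: curvature_def Rm_def algebra_simps)
qed

lemma ricci_eq: "x \<in> U \<Longrightarrow> ricci G x $ j $ k = (\<Sum>i\<in>UNIV. Rm i j x $ i $ k)"
  by (simp add: ricci_def curvature_coord matrix_vector_mult_basis column_def)

lemma ricci_mixed_eq: "x \<in> U \<Longrightarrow> ricci_mixed k m x = (ricci G x ** Ginv x) $ k $ m"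
  unfolding ricci_mixed_def Rm_up_def
  by (simp add: matrix_matrix_mult_def ricci_eq sum_distrib_right) (rule sum.swap)

end


section \<open>Ricci solitons whose potential field is unit and closed\<close>

text \<open>The soliton equation in one coordinate domain, for a potential field of unit length whose dual
  1-form \<open>G \<xi>\<close> is closed.\<close>

locale unit_closed_soliton_domain = metric_domain U G
  for U :: "(real^'n::finite) set" and G +
  fixes xi :: "real^'n \<Rightarrow> real^'n" and lam :: real
  assumes smooth_xi: "smooth_on U xi"
    and unit: "x \<in> U \<Longrightarrow> bilin (G x) (xi x) (xi x) = 1"
    and closed: "x \<in> U \<Longrightarrow> ext_deriv1 (\<lambda>y. G y *v xi y) x i j = 0"
    and soliton: "x \<in> U \<Longrightarrow> (1/2) *\<^sub>R lie_deriv xi G x + ricci G x = lam *\<^sub>R G x"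
begin

text \<open>The vector \<open>\<nabla>\<^sub>i \<xi>\<close>.\<close>

definition nabla_xi :: "'n \<Rightarrow> real^'n \<Rightarrow> real^'n"
  where "nabla_xi i x = pderiv_at i xi x + Gam i x *v xi x"

text \<open>The endomorphism \<open>V \<mapsto> \<nabla>\<^sub>V \<xi>\<close>.\<close>

definition S :: "real^'n \<Rightarrow> real^'n^'n"
  where "S x = (\<chi> k i. nabla_xi i x $ k)"

text \<open>The divergence of \<open>\<xi>\<close>, that is, the trace of \<open>S\<close>.\<close>

definition div_xi :: "real^'n \<Rightarrow> real"
  where "div_xi x = (\<Sum>i\<in>UNIV. nabla_xi i x $ i)"

lemmas differentiable_xi = smooth_on_differentiable[OF smooth_xi]

lemma smooth_nabla_xi: "smooth_on U (nabla_xi i)"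
  unfolding nabla_xi_def[abs_def]
  by (intro smooth_on_add open_domain smooth_on_pderiv_at smooth_xi smooth_Gam
      smooth_on_bounded_bilinear[OF open_domain bounded_bilinear_matrix_vector_mult])

lemmas differentiable_nabla_xi = smooth_on_differentiable[OF smooth_nabla_xi]

lemma metric_S_component: "(G x ** S x) $ j $ i = (G x *v nabla_xi i x) $ j"
  by (simp add: S_def matrix_matrix_mult_def matrix_vector_mult_def)

text \<open>\<open>S\<close> is self-adjoint: \<open>(G S)\<^sub>j\<^sub>i\<close> differs from \<open>\<partial>\<^sub>i \<eta>\<^sub>j\<close> by a term symmetric in \<open>i\<close> and \<open>j\<close>, and \<open>\<eta>\<close> is
  closed.\<close>

lemma metric_S_sym:
  assumes x: "x \<in> U"
  shows "(G x ** S x) $ i $ j = (G x ** S x) $ j $ i"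
proof -
  have d: "pderiv_at i (\<lambda>y. (G y *v xi y) $ j) x
      = (G x ** S x) $ j $ i + (transpose (Gam i x) *v (G x *v xi x)) $ j" for i j
  proof -
    have "pderiv_at i (\<lambda>y. (G y *v xi y) $ j) x = pderiv_at i (\<lambda>y. G y *v xi y) x $ j"
      by (intro pderiv_at_nth differentiable_bounded_bilinear[OF bounded_bilinear_matrix_vector_mult]
          differentiable_metric differentiable_xi x)
    also have "pderiv_at i (\<lambda>y. G y *v xi y) x = G x *v pderiv_at i xi x + pderiv_at i G x *v xi x"
      by (rule pderiv_at_matrix_vector_mult[OF differentiable_metric[OF x] differentiable_xi[OF x]])
    also have "\<dots> = G x *v nabla_xi i x + transpose (Gam i x) *v (G x *v xi x)"
      unfolding pderiv_metric[OF x] nabla_xi_def matrix_vector_mul_assoc matrix_vector_right_distrib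
        matrix_vector_mult_add_rdistrib by simp
    finally show ?thesis by (simp only: metric_S_component vector_add_component)
  qed
  have "(transpose (Gam i x) *v (G x *v xi x)) $ j = (transpose (Gam j x) *v (G x *v xi x)) $ i"
    unfolding matrix_vector_mult_def[of "transpose _"] using Gam_sym[OF x, of i _ j]
    by (simp add: transpose_def)
  then show ?thesis
    using closed[OF x, of i j] unfolding ext_deriv1_def d by simp
qed

lemma xi_metric_nabla_xi:
  assumes x: "x \<in> U"
  shows "xi x \<bullet> (G x *v nabla_xi i x) = 0"
proof -
  have swap: "u \<bullet> (G x *v v) = v \<bullet> (G x *v u)" for u v
    by (metis metric_sym[OF x] dot_lmul_matrix inner_commute transpose_matrix_vector)
  have "0 = pderiv_at i (\<lambda>y. 1::real) x" by simp
  also have "\<dots> = pderiv_at i (\<lambda>y. xi y \<bullet> (G y *v xi y)) x"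
    by (rule pderiv_at_cong[OF open_domain x]) (metis unit bilin_def)
  also have "\<dots> = xi x \<bullet> (G x *v pderiv_at i xi x + pderiv_at i G x *v xi x)
      + pderiv_at i xi x \<bullet> (G x *v xi x)"
    by (simp add: pderiv_at_bounded_bilinear[OF bounded_bilinear_inner] pderiv_at_matrix_vector_mult
      differentiable_metric[OF x] differentiable_xi[OF x]
      differentiable_bounded_bilinear[OF bounded_bilinear_matrix_vector_mult])
  also have "\<dots> = 2 * (xi x \<bullet> (G x *v pderiv_at i xi x)) + xi x \<bullet> (pderiv_at i G x *v xi x)"
    using swap[of "xi x" "pderiv_at i xi x"] by (simp add: inner_add_right)
  also have "xi x \<bullet> (pderiv_at i G x *v xi x) = 2 * (xi x \<bullet> (G x *v (Gam i x *v xi x)))"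
  proof -
    have "xi x \<bullet> (transpose (Gam i x) *v (G x *v xi x)) = (Gam i x *v xi x) \<bullet> (G x *v xi x)"
      by (metis dot_lmul_matrix inner_commute transpose_matrix_vector)
    then show ?thesis
      using swap[of "Gam i x *v xi x" "xi x"]
      unfolding pderiv_metric[OF x] matrix_vector_mult_add_rdistrib matrix_vector_mul_assoc[symmetric]
        inner_add_right by linarith
  qed
  finally show ?thesis by (simp add: nabla_xi_def matrix_vector_right_distrib inner_add_right)
qed

text \<open>The field \<open>\<xi>\<close> is geodesic: by self-adjointness, \<open>g(S\<xi>,V) = g(\<xi>,\<nabla>\<^sub>V\<xi>)\<close>, which vanishes for a unit field.\<close>

lemma S_xi:
  assumes x: "x \<in> U"
  shows "S x *v xi x = 0"
proof -
  have "(G x *v (S x *v xi x)) $ i = 0" for i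
  proof -
    have "(G x *v (S x *v xi x)) $ i = (\<Sum>j\<in>UNIV. (G x ** S x) $ i $ j * xi x $ j)"
      by (simp add: matrix_vector_mul_assoc) (simp add: matrix_vector_mult_def)
    also have "\<dots> = (\<Sum>j\<in>UNIV. (G x *v nabla_xi i x) $ j * xi x $ j)"
      using metric_S_sym[OF x, of i] metric_S_component[of x _ i] by simp
    also have "\<dots> = 0"
      using xi_metric_nabla_xi[OF x, of i] by (simp add: inner_vec_def mult.commute)
    finally show ?thesis .
  qed
  then have "G x *v (S x *v xi x) = 0" by (simp add: vec_eq_iff)
  then have "Ginv x *v (G x *v (S x *v xi x)) = 0" by simp
  then show ?thesis by (simp add: matrix_vector_mul_assoc matrix_mul_assoc metric_mult_inverse x)
qed

lemma sum_xi_nabla_xi: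
  assumes x: "x \<in> U"
  shows "(\<Sum>k\<in>UNIV. xi x $ k * nabla_xi k x $ a) = 0"
  using arg_cong[OF S_xi[OF x], of "\<lambda>v. v $ a"] by (simp add: S_def matrix_vector_mult_def mult.commute)

lemma half_lie_deriv:
  assumes x: "x \<in> U"
  shows "(1/2) *\<^sub>R lie_deriv xi G x = G x ** S x"
proof -
  have "lie_deriv xi G x $ i $ j = 2 * (G x ** S x) $ i $ j" for i j
  proof -
    have br: "lie_bracket xi (\<lambda>y. axis i 1) x = - pderiv_at i xi x" for i
    proof -
      have "(\<Sum>a\<in>UNIV. axis i 1 $ a *\<^sub>R pderiv_at a xi x) = pderiv_at i xi x"
        by (simp add: axis_def if_distrib if_distribR sum.delta cong: if_cong)
      then show ?thesis
        by (simp add: lie_bracket_def dir_deriv_def)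
    qed
    have swap: "u \<bullet> (G x *v v) = v \<bullet> (G x *v u)" for u v
      by (metis metric_sym[OF x] dot_lmul_matrix inner_commute transpose_matrix_vector)
    have dd: "dir_deriv xi (\<lambda>y. G y $ i $ j) x
        = (G x *v (Gam i x *v xi x)) $ j + (G x *v (Gam j x *v xi x)) $ i"
    proof -
      have L: "(\<Sum>k\<in>UNIV. xi x $ k * (G x ** Gam k x) $ i $ j) = (G x *v (Gam j x *v xi x)) $ i" for i j
      proof -
        have "(G x *v (Gam j x *v xi x)) $ i = (\<Sum>a\<in>UNIV. \<Sum>k\<in>UNIV. xi x $ k * (G x $ i $ a * Gam j x $ a $ k))"
          by (simp add: matrix_vector_mult_def sum_distrib_left mult_ac)
        also have "\<dots> = (\<Sum>k\<in>UNIV. \<Sum>a\<in>UNIV. xi x $ k * (G x $ i $ a * Gam k x $ a $ j))"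
          by (subst sum.swap) (simp add: Gam_sym[OF x, of j])
        finally show ?thesis by (simp add: matrix_matrix_mult_def sum_distrib_left)
      qed
      have T: "(transpose (Gam k x) ** G x) $ i $ j = (G x ** Gam k x) $ j $ i" for k
        using arg_cong[OF matrix_transpose_mul[of "G x" "Gam k x"], of "\<lambda>A. A $ i $ j"]
        by (simp add: metric_sym[OF x]) (simp add: transpose_def)
      have "dir_deriv xi (\<lambda>y. G y $ i $ j) x
        = (\<Sum>k\<in>UNIV. xi x $ k * (G x ** Gam k x) $ j $ i) + (\<Sum>k\<in>UNIV. xi x $ k * (G x ** Gam k x) $ i $ j)"
        by (simp add: dir_deriv_def pderiv_at_nth2 differentiable_metric[OF x] pderiv_metric[OF x] T
            distrib_left sum.distrib)
      then show ?thesis unfolding L .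
    qed
    have "lie_deriv xi G x $ i $ j = dir_deriv xi (\<lambda>y. G y $ i $ j) x
        + (G x *v pderiv_at i xi x) $ j + (G x *v pderiv_at j xi x) $ i"
      by (simp add: lie_deriv_def bilin_def br coord_field_def inner_axis' swap[of _ "axis j 1"]
          bounded_bilinear.minus_right[OF bounded_bilinear_matrix_vector_mult])
    also have "\<dots> = (G x ** S x) $ j $ i + (G x ** S x) $ i $ j"
      unfolding dd metric_S_component nabla_xi_def by (simp add: matrix_vector_right_distrib)
    finally show ?thesis using metric_S_sym[OF x, of i j] by simp
  qed
  then show ?thesis by (simp add: vec_eq_iff)
qed

lemma ricci_soliton_domain: "x \<in> U \<Longrightarrow> ricci G x = lam *\<^sub>R G x - G x ** S x"
  using soliton[of x] half_lie_deriv[of x] by (simp add: eq_diff_eq add.commute)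

lemma ricci_mixed_soliton:
  assumes x: "x \<in> U"
  shows "ricci_mixed k m x = (if k = m then lam else 0) - nabla_xi k x $ m"
proof -
  have "transpose (G x ** S x) = G x ** S x"
    by (simp add: vec_eq_iff transpose_def metric_S_sym[OF x])
  then have "G x ** S x = transpose (S x) ** G x"
    by (simp add: matrix_transpose_mul metric_sym x)
  then have "G x ** S x ** Ginv x = transpose (S x)"
    by (simp add: metric_mult_inverse x flip: matrix_mul_assoc)
  then have "ricci G x ** Ginv x = lam *\<^sub>R mat 1 - transpose (S x)"
    by (simp add: ricci_soliton_domain x matrix_mult.diff_left matrix_mult.scaleR_left metric_mult_inverse)
  then show ?thesis
    by (simp add: ricci_mixed_eq x mat_def transpose_def S_def)
qed

lemma ricci_identity:
  assumes x: "x \<in> U"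
  shows "Rm i j x *v xi x = (pderiv_at i (nabla_xi j) x + Gam i x *v nabla_xi j x)
    - (pderiv_at j (nabla_xi i) x + Gam j x *v nabla_xi i x)"
proof -
  have d: "pderiv_at i (nabla_xi j) x = pderiv_at i (pderiv_at j xi) x
      + (Gam j x *v pderiv_at i xi x + pderiv_at i (Gam j) x *v xi x)" for i j
    unfolding nabla_xi_def[abs_def]
    by (simp add: pderiv_at_add pderiv_at_matrix_vector_mult differentiable_xi[OF x] differentiable_Gam[OF x]
        smooth_on_differentiable[OF smooth_on_pderiv_at[OF smooth_xi] x]
        differentiable_bounded_bilinear[OF bounded_bilinear_matrix_vector_mult])
  have "pderiv_at i (pderiv_at j xi) x = pderiv_at j (pderiv_at i xi) x"
    by (rule pderiv_at_commute[OF open_domain x smooth_xi])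
  then show ?thesis
    unfolding d by (simp add: nabla_xi_def Rm_def matrix_vector_mul_assoc algebra_simps)
qed

text \<open>The divergence \<open>\<nabla>\<^sub>i \<nabla>\<^sub>k \<xi>\<^sup>i\<close> of the tensor \<open>\<nabla>\<^sub>k \<xi>\<^sup>i\<close> in its upper index.\<close>

definition div_nabla_xi :: "'n \<Rightarrow> real^'n \<Rightarrow> real"
  where "div_nabla_xi k x = (\<Sum>i\<in>UNIV. pderiv_at i (nabla_xi k) x $ i) + (\<Sum>i\<in>UNIV. (Gam i x *v nabla_xi k x) $ i)
    - (\<Sum>i\<in>UNIV. (Gam k x *v nabla_xi i x) $ i)"

lemma pderiv_div_xi:
  assumes x: "x \<in> U"
  shows "pderiv_at k div_xi x = (\<Sum>i\<in>UNIV. pderiv_at k (nabla_xi i) x $ i)"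
  unfolding div_xi_def[abs_def]
  by (simp add: pderiv_at_sum pderiv_at_nth differentiable_nabla_xi[OF x]
      differentiable_bounded_linear[OF bounded_linear_vec_nth])

text \<open>The trace of the Ricci identity: \<open>Ric(\<xi>) = div \<nabla>\<xi> - d(div \<xi>)\<close>. The soliton equation gives
  a second relation between these quantities, \<open>div_nabla_xi_bianchi\<close>.\<close>

lemma ricci_xi_bochner:
  assumes x: "x \<in> U"
  shows "(ricci G x *v xi x) $ k = div_nabla_xi k x - pderiv_at k div_xi x"
proof -
  have "(ricci G x *v xi x) $ k = (\<Sum>a\<in>UNIV. \<Sum>i\<in>UNIV. Rm i k x $ i $ a * xi x $ a)"
    by (simp add: matrix_vector_mult_def ricci_eq x sum_distrib_right)
  also have "\<dots> = (\<Sum>i\<in>UNIV. (Rm i k x *v xi x) $ i)"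
    unfolding matrix_vector_mult_def by (subst sum.swap) simp
  also have "\<dots> = div_nabla_xi k x - pderiv_at k div_xi x"
    unfolding ricci_identity[OF x] pderiv_div_xi[OF x] div_nabla_xi_def
    by (simp add: sum.distrib sum_subtractf)
  finally show ?thesis .
qed

text \<open>The contracted Bianchi identity for \<open>Ric = \<lambda> g - g S\<close>; the terms with \<open>\<lambda>\<close> cancel.\<close>

lemma div_nabla_xi_bianchi:
  assumes x: "x \<in> U"
  shows "2 * div_nabla_xi k x = pderiv_at k div_xi x"
proof -
  have dRc: "pderiv_at i (ricci_mixed k m) x = - (pderiv_at i (nabla_xi k) x $ m)" for i k m
  proof -
    have "pderiv_at i (ricci_mixed k m) x = pderiv_at i (\<lambda>y. (if k = m then lam else 0) - nabla_xi k y $ m) x"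
      by (rule pderiv_at_cong[OF open_domain x ricci_mixed_soliton])
    then show ?thesis
      by (simp add: pderiv_at_diff pderiv_at_nth differentiable_nabla_xi[OF x]
        differentiable_bounded_linear[OF bounded_linear_vec_nth])
  qed
  have scal: "pderiv_at k (\<lambda>y. \<Sum>j\<in>UNIV. ricci_mixed j j y) x = - pderiv_at k div_xi x"
    by (simp add: pderiv_at_sum smooth_on_differentiable[OF smooth_ricci_mixed x] dRc pderiv_div_xi[OF x] sum_negf)
  have 1: "(\<Sum>m\<in>UNIV. \<Sum>i\<in>UNIV. ricci_mixed k m x * Gam i x $ i $ m)
      = lam * (\<Sum>i\<in>UNIV. Gam i x $ i $ k) - (\<Sum>i\<in>UNIV. (Gam i x *v nabla_xi k x) $ i)"
  proof -
    have "(\<Sum>m\<in>UNIV. \<Sum>i\<in>UNIV. ricci_mixed k m x * Gam i x $ i $ m)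
      = (\<Sum>m\<in>UNIV. (if k = m then lam * (\<Sum>i\<in>UNIV. Gam i x $ i $ m) else 0)
          - (\<Sum>i\<in>UNIV. Gam i x $ i $ m * nabla_xi k x $ m))"
      by (intro sum.cong refl)
        (auto simp: ricci_mixed_soliton[OF x] algebra_simps sum_subtractf sum_distrib_left sum_negf)
    also have "\<dots> = lam * (\<Sum>i\<in>UNIV. Gam i x $ i $ k)
        - (\<Sum>m\<in>UNIV. \<Sum>i\<in>UNIV. Gam i x $ i $ m * nabla_xi k x $ m)"
      by (simp add: sum_subtractf)
    also have "(\<Sum>m\<in>UNIV. \<Sum>i\<in>UNIV. Gam i x $ i $ m * nabla_xi k x $ m)
        = (\<Sum>i\<in>UNIV. (Gam i x *v nabla_xi k x) $ i)"
      unfolding matrix_vector_mult_def by (subst sum.swap) simp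
    finally show ?thesis .
  qed
  have 2: "(\<Sum>j\<in>UNIV. \<Sum>m\<in>UNIV. Gam k x $ j $ m * ricci_mixed j m x)
      = lam * (\<Sum>i\<in>UNIV. Gam k x $ i $ i) - (\<Sum>i\<in>UNIV. (Gam k x *v nabla_xi i x) $ i)"
  proof -
    have "(\<Sum>m\<in>UNIV. Gam k x $ j $ m * ricci_mixed j m x)
        = lam * Gam k x $ j $ j - (Gam k x *v nabla_xi j x) $ j" for j
    proof -
      have "(\<Sum>m\<in>UNIV. Gam k x $ j $ m * ricci_mixed j m x)
        = (\<Sum>m\<in>UNIV. (if j = m then lam * Gam k x $ j $ m else 0) - Gam k x $ j $ m * nabla_xi j x $ m)"
        by (intro sum.cong refl) (simp add: ricci_mixed_soliton[OF x] right_diff_distrib)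
      then show ?thesis by (simp add: sum_subtractf matrix_vector_mult_def)
    qed
    then show ?thesis by (simp add: sum_subtractf sum_distrib_left)
  qed
  have 3: "(\<Sum>i\<in>UNIV. Gam i x $ i $ k) = (\<Sum>i\<in>UNIV. Gam k x $ i $ i)"
    by (intro sum.cong refl Gam_sym[OF x])
  have 4: "(\<Sum>i\<in>UNIV. pderiv_at i (ricci_mixed k i) x) = - (\<Sum>i\<in>UNIV. pderiv_at i (nabla_xi k) x $ i)"
    by (simp add: dRc sum_negf)
  show ?thesis
    using contracted_bianchi[OF x, of k] unfolding scal 1 2 3 4 div_nabla_xi_def
    by (simp add: algebra_simps)
qed

text \<open>The divergence of \<open>S\<xi> = 0\<close>.\<close>

lemma xi_div_nabla_xi:
  assumes x: "x \<in> U"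
  shows "(\<Sum>k\<in>UNIV. xi x $ k * div_nabla_xi k x)
    = - (\<Sum>i\<in>UNIV. \<Sum>k\<in>UNIV. nabla_xi i x $ k * nabla_xi k x $ i)"
proof -
  have D: "(\<Sum>k\<in>UNIV. xi x $ k * pderiv_at i (nabla_xi k) x $ i)
      = - (\<Sum>k\<in>UNIV. pderiv_at i xi x $ k * nabla_xi k x $ i)" for i
  proof -
    have "0 = pderiv_at i (\<lambda>y. 0::real) x" by simp
    also have "\<dots> = pderiv_at i (\<lambda>y. \<Sum>k\<in>UNIV. xi y $ k * nabla_xi k y $ i) x"
      by (rule pderiv_at_cong[OF open_domain x]) (simp add: sum_xi_nabla_xi)
    also have "\<dots> = (\<Sum>k\<in>UNIV. xi x $ k * pderiv_at i (nabla_xi k) x $ i + pderiv_at i xi x $ k * nabla_xi k x $ i)"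
      by (simp add: pderiv_at_sum pderiv_at_bounded_bilinear[OF bounded_bilinear_mult] pderiv_at_nth
          differentiable_nabla_xi[OF x] differentiable_xi[OF x]
          differentiable_bounded_bilinear[OF bounded_bilinear_mult]
          differentiable_bounded_linear[OF bounded_linear_vec_nth])
    finally show ?thesis by (simp add: sum.distrib)
  qed
  have 1: "(\<Sum>k\<in>UNIV. xi x $ k * (\<Sum>i\<in>UNIV. pderiv_at i (nabla_xi k) x $ i))
      = - (\<Sum>i\<in>UNIV. \<Sum>k\<in>UNIV. pderiv_at i xi x $ k * nabla_xi k x $ i)"
    unfolding sum_distrib_left by (subst sum.swap) (simp add: D sum_negf)
  have 2: "(\<Sum>k\<in>UNIV. xi x $ k * (\<Sum>i\<in>UNIV. (Gam i x *v nabla_xi k x) $ i)) = 0"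
  proof -
    have "(\<Sum>k\<in>UNIV. xi x $ k * (\<Sum>i\<in>UNIV. (Gam i x *v nabla_xi k x) $ i))
      = (\<Sum>i\<in>UNIV. \<Sum>k\<in>UNIV. \<Sum>m\<in>UNIV. xi x $ k * (Gam i x $ i $ m * nabla_xi k x $ m))"
      unfolding sum_distrib_left matrix_vector_mult_def vec_lambda_beta by (rule sum.swap)
    also have "\<dots> = (\<Sum>i\<in>UNIV. \<Sum>m\<in>UNIV. \<Sum>k\<in>UNIV. xi x $ k * (Gam i x $ i $ m * nabla_xi k x $ m))"
      by (rule sum.cong[OF refl], rule sum.swap)
    also have "\<dots> = (\<Sum>i\<in>UNIV. \<Sum>m\<in>UNIV. Gam i x $ i $ m * (\<Sum>k\<in>UNIV. xi x $ k * nabla_xi k x $ m))"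
      by (simp add: sum_distrib_left mult_ac)
    finally show ?thesis by (simp add: sum_xi_nabla_xi[OF x])
  qed
  have 3: "(\<Sum>k\<in>UNIV. xi x $ k * (\<Sum>i\<in>UNIV. (Gam k x *v nabla_xi i x) $ i))
      = (\<Sum>i\<in>UNIV. \<Sum>k\<in>UNIV. (Gam i x *v xi x) $ k * nabla_xi k x $ i)"
  proof -
    have "(\<Sum>k\<in>UNIV. xi x $ k * (\<Sum>i\<in>UNIV. (Gam k x *v nabla_xi i x) $ i))
      = (\<Sum>k\<in>UNIV. \<Sum>i\<in>UNIV. \<Sum>m\<in>UNIV. Gam m x $ i $ k * xi x $ k * nabla_xi i x $ m)"
      unfolding sum_distrib_left matrix_vector_mult_def vec_lambda_beta
    proof (intro sum.cong refl)
      fix k i m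
      show "xi x $ k * (Gam k x $ i $ m * nabla_xi i x $ m) = Gam m x $ i $ k * xi x $ k * nabla_xi i x $ m"
        using Gam_sym[OF x, of k i m] by simp
    qed
    also have "\<dots> = (\<Sum>i\<in>UNIV. \<Sum>k\<in>UNIV. \<Sum>m\<in>UNIV. Gam m x $ i $ k * xi x $ k * nabla_xi i x $ m)"
      by (rule sum.swap)
    also have "\<dots> = (\<Sum>i\<in>UNIV. \<Sum>m\<in>UNIV. \<Sum>k\<in>UNIV. Gam m x $ i $ k * xi x $ k * nabla_xi i x $ m)"
      by (rule sum.cong[OF refl], rule sum.swap)
    also have "\<dots> = (\<Sum>m\<in>UNIV. \<Sum>i\<in>UNIV. \<Sum>k\<in>UNIV. Gam m x $ i $ k * xi x $ k * nabla_xi i x $ m)"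
      by (rule sum.swap)
    finally show ?thesis by (simp add: matrix_vector_mult_def sum_distrib_right)
  qed
  have "(\<Sum>k\<in>UNIV. xi x $ k * div_nabla_xi k x)
      = - (\<Sum>i\<in>UNIV. \<Sum>k\<in>UNIV. pderiv_at i xi x $ k * nabla_xi k x $ i)
        - (\<Sum>i\<in>UNIV. \<Sum>k\<in>UNIV. (Gam i x *v xi x) $ k * nabla_xi k x $ i)"
    unfolding div_nabla_xi_def right_diff_distrib distrib_left sum.distrib sum_subtractf 1 2 3 by simp
  also have "\<dots> = - (\<Sum>i\<in>UNIV. \<Sum>k\<in>UNIV.
      (pderiv_at i xi x $ k + (Gam i x *v xi x) $ k) * nabla_xi k x $ i)"
    by (simp add: distrib_right sum.distrib)
  finally show ?thesis
    unfolding nabla_xi_def[of _ x] by simp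
qed

lemma lam_eq_trace_square:
  assumes x: "x \<in> U"
  shows "lam = (\<Sum>i\<in>UNIV. \<Sum>k\<in>UNIV. S x $ k $ i * S x $ i $ k)"
proof -
  have "ricci G x *v xi x = lam *\<^sub>R (G x *v xi x)"
    by (simp add: ricci_soliton_domain x matrix_vector_mult_diff_rdistrib scaleR_matrix_vector_assoc
        S_xi flip: matrix_vector_mul_assoc)
  then have "xi x \<bullet> (ricci G x *v xi x) = lam"
    using unit[OF x] by (simp add: bilin_def)
  moreover have "(ricci G x *v xi x) $ k = - div_nabla_xi k x" for k
    using ricci_xi_bochner[OF x, of k] div_nabla_xi_bianchi[OF x, of k] by simp
  then have "xi x \<bullet> (ricci G x *v xi x) = - (\<Sum>k\<in>UNIV. xi x $ k * div_nabla_xi k x)"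
    by (simp add: inner_vec_def sum_negf)
  ultimately show ?thesis
    unfolding xi_div_nabla_xi[OF x] by (simp add: S_def)
qed

text \<open>With \<open>B = G S\<close> symmetric, \<open>tr S\<^sup>2\<close> is the trace of the product of the positive semidefinite matrices
  \<open>G\<^sup>-\<^sup>1\<close> and \<open>B G\<^sup>-\<^sup>1 B\<close>.\<close>

lemma lam_nonneg:
  assumes x: "x \<in> U"
  shows "lam \<ge> 0"
proof -
  define B where "B = G x ** S x"
  have B: "transpose B = B" by (simp add: B_def vec_eq_iff transpose_def metric_S_sym[OF x])
  have S: "S x = Ginv x ** B" by (simp add: B_def matrix_mul_assoc metric_mult_inverse x)
  define P where "P = B ** Ginv x ** B"
  have Ginv_component_sym: "Ginv x $ a $ b = Ginv x $ b $ a" for a b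
    using arg_cong[OF inverse_metric_sym[OF x], of "\<lambda>A. A $ b $ a"] by (simp add: transpose_def)
  have "(\<Sum>i\<in>UNIV. \<Sum>k\<in>UNIV. S x $ k $ i * S x $ i $ k) = (\<Sum>k\<in>UNIV. (S x ** S x) $ k $ k)"
    unfolding matrix_matrix_mult_def vec_lambda_beta by (rule sum.swap)
  also have "\<dots> = (\<Sum>a\<in>UNIV. \<Sum>b\<in>UNIV. Ginv x $ a $ b * P $ b $ a)"
  proof -
    have "S x ** S x = Ginv x ** P" by (simp add: S P_def matrix_mul_assoc)
    then show ?thesis by (simp add: matrix_matrix_mult_def)
  qed
  also have "\<dots> = (\<Sum>a\<in>UNIV. \<Sum>b\<in>UNIV. Ginv x $ a $ b * P $ a $ b)"
    by (subst sum.swap) (simp add: Ginv_component_sym)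
  finally have "lam = (\<Sum>a\<in>UNIV. \<Sum>b\<in>UNIV. Ginv x $ a $ b * P $ a $ b)"
    using lam_eq_trace_square[OF x] by simp
  moreover have "u \<bullet> (P *v u) \<ge> 0" for u
  proof -
    have "u \<bullet> (P *v u) = u \<bullet> (transpose B *v (Ginv x *v (B *v u)))"
      by (simp only: P_def B flip: matrix_vector_mul_assoc)
    also have "\<dots> = (B *v u) \<bullet> (Ginv x *v (B *v u))"
      by (metis dot_lmul_matrix inner_commute transpose_matrix_vector)
    finally show ?thesis using inverse_metric_nonneg[OF x] by simp
  qed
  ultimately show ?thesis
    using sum_product_nonneg_of_positive_semidefinite[OF inverse_metric_sym[OF x] inverse_metric_nonneg[OF x]]
    by simp
qed

end


section \<open>Almost cosymplectic Ricci solitons\<close>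

theorem corollary4p2:
  fixes M :: "'a topology" and A :: "('a, 'n::finite) chart set"
    and g \<phi> :: "('a, 'n, real^'n^'n) field_on_charts"
    and \<xi> \<eta> :: "('a, 'n, real^'n) field_on_charts"
    and \<alpha> lam :: real
  assumes "almost_cosymplectic_manifold M A g \<phi> \<xi> \<eta> \<alpha>"
    and "ricci_soliton M A g \<xi> lam"
  shows "lam \<ge> 0"
proof -
  interpret almost_cosymplectic_manifold M A g \<phi> \<xi> \<eta> \<alpha> by (rule assms(1))
  interpret ricci_soliton M A g \<xi> lam by (rule assms(2))
  obtain p c where c: "c \<in> A" "p \<in> fst c" using nonempty covers by blast
  then have p: "snd c p \<in> chart_image c" by (simp add: chart_image_def)
  have eta: "\<eta> c x = g c x *v \<xi> c x" if "x \<in> chart_image c" for x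
  proof -
    have "\<eta> c x \<bullet> U = (g c x *v \<xi> c x) \<bullet> U" for U
    proof -
      have "\<xi> c x \<bullet> (g c x *v U) = (transpose (g c x) *v \<xi> c x) \<bullet> U"
        by (metis dot_lmul_matrix transpose_matrix_vector)
      then show ?thesis
        using eta_dual[OF c(1) that, of U] metric_symmetric[OF c(1) that] by (simp add: bilin_def)
    qed
    then show ?thesis by (metis inner_commute vector_eq_ldot)
  qed
  have op: "open (chart_image c)" using chart_open[OF c(1)] by blast
  interpret unit_closed_soliton_domain "chart_image c" "g c" "\<xi> c" lam
  proof
    show "open (chart_image c)" by (rule op)
    show "smooth_on (chart_image c) (g c)"
      using metric_tensor c(1) by (simp add: tensor_field_0_2_def is_tensor_field_def)
    show "smooth_on (chart_image c) (\<xi> c)"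
      using xi_field c(1) by (simp add: vector_field_def is_tensor_field_def)
    fix x assume x: "x \<in> chart_image c"
    show "transpose (g c x) = g c x" by (rule metric_symmetric[OF c(1) x])
    show "bilin (g c x) V V > 0" if "V \<noteq> 0" for V by (rule metric_pos[OF c(1) x that])
    show "bilin (g c x) (\<xi> c x) (\<xi> c x) = 1" by (rule xi_unit[OF c(1) x])
    show "(1/2) *\<^sub>R lie_deriv (\<xi> c) (g c) x + ricci (g c) x = lam *\<^sub>R g c x"
      by (rule soliton[OF c(1) x])
    fix i j
    have "pderiv_at i (\<lambda>y. (g c y *v \<xi> c y) $ j) x = pderiv_at i (\<lambda>y. \<eta> c y $ j) x" for i j
      by (rule pderiv_at_cong[OF op x]) (simp add: eta)
    then show "ext_deriv1 (\<lambda>y. g c y *v \<xi> c y) x i j = 0"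
      using eta_closed[OF c(1) x, of i j] by (simp add: ext_deriv1_def)
  qed
  show ?thesis by (rule lam_nonneg[OF p])
qed

end
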